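(* Let $\Gamma$ be a biconnected finite simplicial graph such that the flag complex $\Delta_\Gamma$ is simply connected. Let $\chi\in\operatorname{Hom}(BB_\Gamma,\mathbb R)$ be a non-zero character. Then $[\chi]\in\Sigma^1(BB_\Gamma)$ if and only if the dead edge subgraph $\mathcal{DE}(\chi)$ does not contain a full subgraph of $\Gamma$ that separates $\Gamma$.
   Context: All graphs are finite simplicial graphs. A graph is biconnected if it is connected and has no cut vertex. A subgraph $\Lambda\subseteq\Gamma$ is separating (separates $\Gamma$) if the full subgraph of $\Gamma$ spanned by $V(\Gamma)\setminus V(\Lambda)$ is disconnected; $\Lambda$ is full if it contains every edge of $\Gamma$ between two of its vertices. The flag complex $\Delta_\Gamma$ is the simplicial complex whose simplices are the nonempty sets of pairwise adjacent vertices of $\Gamma$. The right-angled Artin group on $\Gamma$ is $A_\Gamma=\langle V(\Gamma)\mid [v,w] \text{ whenever } (v,w)\in E(\Gamma)\rangle$, and $BB_\Gamma$ is the kernel of the homomorphism $A_\Gamma\to\mathbb Z$ sending every vertex generator to $1$. For $\Gamma$ connected, $BB_\Gamma$ is finitely generated by the oriented edges of $\Gamma$, an oriented edge $e$ with initial vertex $\iota e$ and terminal vertex $\tau e$ being the element $\tau e(\iota e)^{-1}$; reversing orientation inverts the element, so whether a character vanishes on an edge does not depend on orientation. For a finitely generated group $G$, a character is a homomorphism $\chi\colon G\to\mathbb R$; $[\chi]$ denotes its class up to multiplication by positive reals, and the character sphere is $S(G)=\{[\chi]\mid \chi\in\operatorname{Hom}(G,\mathbb R)\setminus\{0\}\}$.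 For a finite generating set $\mathcal S$, the BNS-invariant $\Sigma^1(G)\subseteq S(G)$ is the set of $[\chi]$ such that the full subgraph of the Cayley graph $\operatorname{Cay}(G,\mathcal S)$ spanned by $\{g\in G\mid\chi(g)\ge 0\}$ is connected; it does not depend on $\mathcal S$. The dead edge subgraph $\mathcal{DE}(\chi)$ of a non-zero character $\chi$ of $BB_\Gamma$ is the (not necessarily full) subgraph of $\Gamma$ consisting of the edges $e$ with $\chi(e)=0$ together with their endpoints. *)

theory Defs
  imports
    "HOL-Analysis.Analysis"
    "HOL-Algebra.Elementary_Groups"
    "Graph_Theory.Graph_Theory"
begin

text \<open>
  Finite simplicial graphs are the finite, symmetric, loop-free digraphs without parallel
  arcs of \<^locale>\<open>pair_graph\<close>: an unordered edge is a pair of opposite arcs, so that the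
  arcs are exactly the oriented edges.  The constant \<open>connected\<close> of Graph_Theory requires
  a nonempty vertex set.  The empty graph is regarded as neither connected nor disconnected,
  so that neither the vertex of a one-vertex graph nor the whole graph is separating.
\<close>

definition disconnected_graph :: "('a, 'b) pre_digraph \<Rightarrow> bool" where
  "disconnected_graph G \<longleftrightarrow> verts G \<noteq> {} \<and> \<not> Digraph_Component.connected G"

definition separates :: "('a, 'b) pre_digraph \<Rightarrow> ('a, 'b) pre_digraph \<Rightarrow> bool" where
  "separates H G \<longleftrightarrow> disconnected_graph (G \<restriction> (verts G - verts H))"

definition cut_vertex :: "('a, 'b) pre_digraph \<Rightarrow> 'a \<Rightarrow> bool" where
  "cut_vertex G v \<longleftrightarrow> v \<in> verts G \<and> disconnected_graph (G \<restriction> (verts G - {v}))"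

definition biconnected :: "('a, 'b) pre_digraph \<Rightarrow> bool" where
  "biconnected G \<longleftrightarrow> Digraph_Component.connected G \<and> (\<nexists>v. cut_vertex G v)"

definition flag_complex :: "'v pair_pre_digraph \<Rightarrow> 'v set set" where
  "flag_complex \<Gamma> =
     {\<sigma>. \<sigma> \<noteq> {} \<and> finite \<sigma> \<and> \<sigma> \<subseteq> pverts \<Gamma> \<and> (\<forall>u\<in>\<sigma>. \<forall>v\<in>\<sigma>. u \<noteq> v \<longrightarrow> (u, v) \<in> parcs \<Gamma>)}"

text \<open>
  Barycentric coordinates.  For a complex with finitely many vertices, the topology induced by
  the product topology on \<^typ>\<open>'v \<Rightarrow> real\<close> is the usual topology of the realization.
\<close>

definition geometric_realization :: "'v set set \<Rightarrow> ('v \<Rightarrow> real) set" where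
  "geometric_realization K =
     {x. (\<forall>v. 0 \<le> x v) \<and> {v. x v \<noteq> 0} \<in> K \<and> (\<Sum>v | x v \<noteq> 0. x v) = 1}"

text \<open>The letter \<open>(x, True)\<close> stands for the generator \<open>x\<close>, and \<open>(x, False)\<close> for its inverse.\<close>

type_synonym 'x word = "('x \<times> bool) list"

definition words :: "'x set \<Rightarrow> 'x word set" where
  "words X = lists (X \<times> UNIV)"

inductive_set pres_rel :: "'x set \<Rightarrow> 'x word set \<Rightarrow> ('x word \<times> 'x word) set"
  for X :: "'x set" and R :: "'x word set"
where
  refl: "w \<in> words X \<Longrightarrow> (w, w) \<in> pres_rel X R"
| sym: "(v, w) \<in> pres_rel X R \<Longrightarrow> (w, v) \<in> pres_rel X R"
| trans: "(u, v) \<in> pres_rel X R \<Longrightarrow> (v, w) \<in> pres_rel X R \<Longrightarrow> (u, w) \<in> pres_rel X R"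
| cancel: "u \<in> words X \<Longrightarrow> v \<in> words X \<Longrightarrow> x \<in> X \<Longrightarrow>
    (u @ [(x, b), (x, \<not> b)] @ v, u @ v) \<in> pres_rel X R"
| relator: "u \<in> words X \<Longrightarrow> v \<in> words X \<Longrightarrow> r \<in> R \<inter> words X \<Longrightarrow>
    (u @ r @ v, u @ v) \<in> pres_rel X R"

definition pres_group :: "'x set \<Rightarrow> 'x word set \<Rightarrow> 'x word set monoid" where
  "pres_group X R =
     \<lparr>carrier = words X // pres_rel X R,
      mult = (\<lambda>A B. \<Union>a\<in>A. \<Union>b\<in>B. pres_rel X R `` {a @ b}),
      one = pres_rel X R `` {[]}\<rparr>"

definition pres_gen :: "'x set \<Rightarrow> 'x word set \<Rightarrow> 'x \<Rightarrow> 'x word set" where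
  "pres_gen X R x = pres_rel X R `` {[(x, True)]}"

lemma words_simps [simp]:
  "[] \<in> words X" "a # w \<in> words X \<longleftrightarrow> fst a \<in> X \<and> w \<in> words X"
  "v @ w \<in> words X \<longleftrightarrow> v \<in> words X \<and> w \<in> words X"
  by (cases a; auto simp: words_def)+

lemma pres_rel_words: "(v, w) \<in> pres_rel X R \<Longrightarrow> v \<in> words X \<and> w \<in> words X"
  by (induction rule: pres_rel.induct) auto

lemma equiv_pres_rel: "equiv (words X) (pres_rel X R)"
proof (rule equivI)
  show "pres_rel X R \<subseteq> words X \<times> words X"
    using pres_rel_words by fastforce
  show "refl_on (words X) (pres_rel X R)"
    by (auto simp: refl_on_def intro: pres_rel.refl)
  show "sym (pres_rel X R)"
    by (meson pres_rel.sym symI)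
  show "trans (pres_rel X R)"
    by (meson pres_rel.trans transI)
qed

lemma pres_rel_append_context:
  assumes "(v, w) \<in> pres_rel X R" "a \<in> words X" "b \<in> words X"
  shows "(a @ v @ b, a @ w @ b) \<in> pres_rel X R"
  using assms
proof (induction rule: pres_rel.induct)
  case (cancel u v x c)
  then show ?case
    using pres_rel.cancel[of "a @ u" X "v @ b" x c R] by simp
next
  case (relator u v r)
  then show ?case
    using pres_rel.relator[of "a @ u" X "v @ b" r R] by simp
qed (auto intro: pres_rel.refl pres_rel.sym pres_rel.trans)

lemma pres_rel_append:
  assumes "(v, v') \<in> pres_rel X R" "(w, w') \<in> pres_rel X R"
  shows "(v @ w, v' @ w') \<in> pres_rel X R"
proof -
  have "([] @ v @ w, [] @ v' @ w) \<in> pres_rel X R" "(v' @ w @ [], v' @ w' @ []) \<in> pres_rel X R"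
    using assms pres_rel_words by (blast intro: pres_rel_append_context words_simps(1))+
  then show ?thesis
    by (auto intro: pres_rel.trans)
qed

lemma pres_class_eq_iff:
  assumes "v \<in> words X" "w \<in> words X"
  shows "pres_rel X R `` {v} = pres_rel X R `` {w} \<longleftrightarrow> (v, w) \<in> pres_rel X R"
  using assms equiv_pres_rel eq_equiv_class_iff by metis

lemma pres_mult:
  assumes "v \<in> words X" "w \<in> words X"
  shows "pres_rel X R `` {v} \<otimes>\<^bsub>pres_group X R\<^esub> pres_rel X R `` {w} = pres_rel X R `` {v @ w}"
proof -
  have "pres_rel X R `` {a @ b} = pres_rel X R `` {v @ w}"
    if "a \<in> pres_rel X R `` {v}" "b \<in> pres_rel X R `` {w}" for a b
    using that assms pres_rel_append[of v a X R w b] pres_rel_words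
    by (metis Image_singleton_iff equiv_class_eq equiv_pres_rel)
  moreover have "v \<in> pres_rel X R `` {v}" "w \<in> pres_rel X R `` {w}"
    using assms by (auto intro: pres_rel.refl)
  ultimately have "(\<Union>a\<in>pres_rel X R `` {v}. \<Union>b\<in>pres_rel X R `` {w}. pres_rel X R `` {a @ b}) =
      (\<Union>a\<in>pres_rel X R `` {v}. \<Union>b\<in>pres_rel X R `` {w}. pres_rel X R `` {v @ w})"
    by (intro SUP_cong HOL.refl)
  also have "\<dots> = pres_rel X R `` {v @ w}"
    using \<open>v \<in> pres_rel X R `` {v}\<close> \<open>w \<in> pres_rel X R `` {w}\<close> by (metis SUP_const empty_iff)
  finally show ?thesis
    by (simp add: pres_group_def)
qed

lemma pres_carrierE:
  assumes "A \<in> carrier (pres_group X R)"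
  obtains w where "w \<in> words X" "A = pres_rel X R `` {w}"
  using assms by (auto simp: pres_group_def elim: quotientE)

lemma pres_class_closed: "w \<in> words X \<Longrightarrow> pres_rel X R `` {w} \<in> carrier (pres_group X R)"
  by (simp add: pres_group_def quotientI)

lemma pres_one: "\<one>\<^bsub>pres_group X R\<^esub> = pres_rel X R `` {[]}"
  by (simp add: pres_group_def)

definition inv_word :: "'x word \<Rightarrow> 'x word" where
  "inv_word w = rev (map (\<lambda>(x, b). (x, \<not> b)) w)"

lemma inv_word_words: "w \<in> words X \<Longrightarrow> inv_word w \<in> words X"
  by (induction w) (auto simp: inv_word_def)

lemma inv_word_cancel: "w \<in> words X \<Longrightarrow> (inv_word w @ w, []) \<in> pres_rel X R"
proof (induction w)
  case Nil
  then show ?case by (simp add: inv_word_def pres_rel.refl)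
next
  case (Cons a w)
  obtain x b where a: "a = (x, b)" by (cases a)
  have "(inv_word w @ [(x, \<not> b), (x, \<not> \<not> b)] @ w, inv_word w @ w) \<in> pres_rel X R"
    using Cons.prems a by (intro pres_rel.cancel) (auto intro: inv_word_words)
  with Cons show ?case
    by (auto simp: a inv_word_def intro: pres_rel.trans)
qed

lemma group_pres_group: "group (pres_group X R)"
proof (rule groupI)
  fix A B C
  assume A: "A \<in> carrier (pres_group X R)"
  then obtain a where a: "a \<in> words X" "A = pres_rel X R `` {a}" by (rule pres_carrierE)
  show "\<one>\<^bsub>pres_group X R\<^esub> \<otimes>\<^bsub>pres_group X R\<^esub> A = A"
    using a by (simp add: pres_one pres_mult)
  show "\<exists>B\<in>carrier (pres_group X R). B \<otimes>\<^bsub>pres_group X R\<^esub> A = \<one>\<^bsub>pres_group X R\<^esub>"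
    using a by (intro bexI[of _ "pres_rel X R `` {inv_word a}"])
      (simp_all add: pres_mult pres_one pres_class_eq_iff inv_word_words inv_word_cancel
        pres_class_closed)
  assume B: "B \<in> carrier (pres_group X R)"
  then obtain b where b: "b \<in> words X" "B = pres_rel X R `` {b}" by (rule pres_carrierE)
  show "A \<otimes>\<^bsub>pres_group X R\<^esub> B \<in> carrier (pres_group X R)"
    using a b by (simp add: pres_mult pres_class_closed)
  assume "C \<in> carrier (pres_group X R)"
  then obtain c where c: "c \<in> words X" "C = pres_rel X R `` {c}" by (rule pres_carrierE)
  show "A \<otimes>\<^bsub>pres_group X R\<^esub> B \<otimes>\<^bsub>pres_group X R\<^esub> C = A \<otimes>\<^bsub>pres_group X R\<^esub> (B \<otimes>\<^bsub>pres_group X R\<^esub> C)"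
    using a b c by (simp add: pres_mult)
qed (simp add: pres_one pres_class_closed)

definition raag_relators :: "'v pair_pre_digraph \<Rightarrow> 'v word set" where
  "raag_relators \<Gamma> = {[(v, True), (w, True), (v, False), (w, False)] | v w. (v, w) \<in> parcs \<Gamma>}"

definition raag :: "'v pair_pre_digraph \<Rightarrow> 'v word set monoid" where
  "raag \<Gamma> = pres_group (pverts \<Gamma>) (raag_relators \<Gamma>)"

definition raag_gen :: "'v pair_pre_digraph \<Rightarrow> 'v \<Rightarrow> 'v word set" where
  "raag_gen \<Gamma> = pres_gen (pverts \<Gamma>) (raag_relators \<Gamma>)"

definition exponent_sum :: "'x word \<Rightarrow> int" where
  "exponent_sum w = (\<Sum>(x, b)\<leftarrow>w. if b then 1 else - 1)"

text \<open>
  The exponent sum is constant on each element of \<^term>\<open>raag \<Gamma>\<close>, so \<open>the_elem\<close> is applied to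
  a singleton.
\<close>

definition raag_height :: "'v word set \<Rightarrow> int" where
  "raag_height A = the_elem (exponent_sum ` A)"

definition bb_group :: "'v pair_pre_digraph \<Rightarrow> 'v word set monoid" where
  "bb_group \<Gamma> = (raag \<Gamma>)\<lparr>carrier := kernel (raag \<Gamma>) integer_group raag_height\<rparr>"

definition edge_element :: "'v pair_pre_digraph \<Rightarrow> 'v \<times> 'v \<Rightarrow> 'v word set" where
  "edge_element \<Gamma> e = raag_gen \<Gamma> (snd e) \<otimes>\<^bsub>raag \<Gamma>\<^esub> inv\<^bsub>raag \<Gamma>\<^esub> raag_gen \<Gamma> (fst e)"

lemma group_raag: "group (raag \<Gamma>)"
  by (simp add: raag_def group_pres_group)

lemma exponent_sum_simps [simp]:
  "exponent_sum [] = 0"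
  "exponent_sum ((x, b) # w) = (if b then 1 else - 1) + exponent_sum w"
  "exponent_sum (v @ w) = exponent_sum v + exponent_sum w"
  by (simp_all add: exponent_sum_def)

lemma exponent_sum_pres_rel:
  assumes "(v, w) \<in> pres_rel X R" "\<And>r. r \<in> R \<Longrightarrow> exponent_sum r = 0"
  shows "exponent_sum v = exponent_sum w"
  using assms(1)
  by (induction rule: pres_rel.induct) (simp_all add: assms(2))

lemma raag_height_class:
  assumes "w \<in> words (pverts \<Gamma>)"
  shows "raag_height (pres_rel (pverts \<Gamma>) (raag_relators \<Gamma>) `` {w}) = exponent_sum w"
proof -
  let ?C = "pres_rel (pverts \<Gamma>) (raag_relators \<Gamma>) `` {w}"
  have "exponent_sum v = exponent_sum w" if "v \<in> ?C" for v
    using that by (intro exponent_sum_pres_rel[symmetric]) (auto simp: raag_relators_def)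
  then have "exponent_sum ` ?C = (\<lambda>_. exponent_sum w) ` ?C"
    by (rule image_cong[OF HOL.refl])
  also have "w \<in> ?C"
    using assms by (simp add: pres_rel.refl)
  then have "(\<lambda>_. exponent_sum w) ` ?C = {exponent_sum w}"
    by (rule image_constant)
  finally show ?thesis
    by (simp add: raag_height_def)
qed

lemma raag_height_hom: "raag_height \<in> hom (raag \<Gamma>) integer_group"
proof (rule homI)
  fix A B
  assume A: "A \<in> carrier (raag \<Gamma>)" and B: "B \<in> carrier (raag \<Gamma>)"
  from A obtain a where a: "a \<in> words (pverts \<Gamma>)"
      "A = pres_rel (pverts \<Gamma>) (raag_relators \<Gamma>) `` {a}"
    unfolding raag_def by (rule pres_carrierE)
  from B obtain b where b: "b \<in> words (pverts \<Gamma>)"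
      "B = pres_rel (pverts \<Gamma>) (raag_relators \<Gamma>) `` {b}"
    unfolding raag_def by (rule pres_carrierE)
  have "A \<otimes>\<^bsub>raag \<Gamma>\<^esub> B = pres_rel (pverts \<Gamma>) (raag_relators \<Gamma>) `` {a @ b}"
    unfolding raag_def a(2) b(2) by (rule pres_mult[OF a(1) b(1)])
  moreover have "a @ b \<in> words (pverts \<Gamma>)"
    using a(1) b(1) by simp
  ultimately show "raag_height (A \<otimes>\<^bsub>raag \<Gamma>\<^esub> B) = raag_height A \<otimes>\<^bsub>integer_group\<^esub> raag_height B"
    by (simp add: a b raag_height_class)
qed simp

lemma raag_height_gen: "v \<in> pverts \<Gamma> \<Longrightarrow> raag_height (raag_gen \<Gamma> v) = 1"
  by (simp add: raag_gen_def pres_gen_def raag_height_class)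

lemma raag_gen_closed: "v \<in> pverts \<Gamma> \<Longrightarrow> raag_gen \<Gamma> v \<in> carrier (raag \<Gamma>)"
  by (simp add: raag_gen_def pres_gen_def raag_def pres_class_closed)

lemma raag_height_group_hom: "group_hom (raag \<Gamma>) integer_group raag_height"
  by (intro group_hom.intro group_hom_axioms.intro group_raag group_integer_group raag_height_hom)

lemma group_bb_group: "group (bb_group \<Gamma>)"
  unfolding bb_group_def
  by (rule group.subgroup_imp_group[OF group_raag])
    (rule group_hom.subgroup_kernel[OF raag_height_group_hom])

lemma edge_element_closed:
  assumes "u \<in> pverts \<Gamma>" "v \<in> pverts \<Gamma>"
  shows "edge_element \<Gamma> (u, v) \<in> carrier (bb_group \<Gamma>)"
proof -
  interpret H: group_hom "raag \<Gamma>" integer_group raag_height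
    by (rule raag_height_group_hom)
  have "raag_gen \<Gamma> u \<in> carrier (raag \<Gamma>)" "raag_gen \<Gamma> v \<in> carrier (raag \<Gamma>)"
    using assms by (auto intro: raag_gen_closed)
  moreover from this have "raag_height (edge_element \<Gamma> (u, v)) = 0"
    using assms by (simp add: edge_element_def raag_height_gen H.hom_inv)
  ultimately show ?thesis
    by (simp add: edge_element_def bb_group_def kernel_def)
qed

text \<open>Hence the vanishing of a character on an edge does not depend on the orientation.\<close>

lemma edge_element_swap:
  assumes "u \<in> pverts \<Gamma>" "v \<in> pverts \<Gamma>"
  shows "edge_element \<Gamma> (v, u) = inv\<^bsub>raag \<Gamma>\<^esub> edge_element \<Gamma> (u, v)"
proof -
  interpret G: Group.group "raag \<Gamma>"
    by (rule group_raag)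
  show ?thesis
    using assms by (simp add: edge_element_def raag_gen_closed G.inv_mult_group)
qed

definition real_group :: "real monoid" where
  "real_group = \<lparr>carrier = UNIV, mult = (+), one = 0\<rparr>"

definition nonzero_characters :: "('g, 'm) monoid_scheme \<Rightarrow> ('g \<Rightarrow> real) set" where
  "nonzero_characters G = {\<phi> \<in> hom G real_group. \<exists>g\<in>carrier G. \<phi> g \<noteq> 0}"

text \<open>
  Values outside the carrier are irrelevant: two functions that agree on the carrier have the
  same class.
\<close>

definition character_class :: "('g, 'm) monoid_scheme \<Rightarrow> ('g \<Rightarrow> real) \<Rightarrow> ('g \<Rightarrow> real) set" where
  "character_class G \<phi> =
     {\<psi> \<in> hom G real_group. \<exists>r>0. \<forall>g\<in>carrier G. \<psi> g = r * \<phi> g}"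

definition character_sphere :: "('g, 'm) monoid_scheme \<Rightarrow> ('g \<Rightarrow> real) set set" where
  "character_sphere G = character_class G ` nonzero_characters G"

definition finite_generating_set :: "('g, 'm) monoid_scheme \<Rightarrow> 'g set \<Rightarrow> bool" where
  "finite_generating_set G S \<longleftrightarrow> finite S \<and> S \<subseteq> carrier G \<and> generate G S = carrier G"

text \<open>
  Edges join \<open>g\<close> and \<open>g s\<close>, so that \<open>G\<close> acts on the left.  Both arcs of every edge are included.
\<close>

definition cayley_graph :: "('g, 'm) monoid_scheme \<Rightarrow> 'g set \<Rightarrow> 'g pair_pre_digraph" where
  "cayley_graph G S =
     \<lparr>pverts = carrier G,
      parcs = {(g, h). g \<in> carrier G \<and> h \<in> carrier G \<and>
                 (\<exists>s\<in>S. h = g \<otimes>\<^bsub>G\<^esub> s \<or> g = h \<otimes>\<^bsub>G\<^esub> s)}\<rparr>"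

definition nonneg_connected :: "('g, 'm) monoid_scheme \<Rightarrow> 'g set \<Rightarrow> ('g \<Rightarrow> real) \<Rightarrow> bool" where
  "nonneg_connected G S \<phi> \<longleftrightarrow>
     Digraph_Component.connected (with_proj (cayley_graph G S) \<restriction> {g \<in> carrier G. 0 \<le> \<phi> g})"

definition bns_invariant :: "('g, 'm) monoid_scheme \<Rightarrow> ('g \<Rightarrow> real) set set" where
  "bns_invariant G =
     {character_class G \<phi> | \<phi>. \<phi> \<in> nonzero_characters G \<and>
        (\<exists>S. finite_generating_set G S \<and> nonneg_connected G S \<phi>)}"

lemma bns_invariant_subset: "bns_invariant G \<subseteq> character_sphere G"
  by (auto simp: bns_invariant_def character_sphere_def)

text \<open>The choice of a finite generating set and of a representative of the class is immaterial.\<close>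

lemma cayley_reachable_iff:
  "Digraph_Component.connected (with_proj (cayley_graph G S) \<restriction> P) \<longleftrightarrow>
     P \<noteq> {} \<and> (\<forall>g\<in>P. \<forall>h\<in>P. (g, h) \<in> (parcs (cayley_graph G S) \<inter> P \<times> P)\<^sup>*)"
proof -
  let ?H = "with_proj (cayley_graph G S) \<restriction> P"
  have ends: "arcs_ends ?H = parcs (cayley_graph G S) \<inter> P \<times> P"
    by (force simp: arcs_ends_conv)
  have "sym (parcs (cayley_graph G S) \<inter> P \<times> P)"
    by (auto simp: cayley_graph_def sym_def)
  then have "(arcs_ends ?H)\<^sup>s = parcs (cayley_graph G S) \<inter> P \<times> P"
    by (auto simp: symcl_def ends sym_def)
  moreover have "(g, h) \<in> rtrancl_on P (parcs (cayley_graph G S) \<inter> P \<times> P) \<longleftrightarrow>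
      (g, h) \<in> (parcs (cayley_graph G S) \<inter> P \<times> P)\<^sup>*" if "g \<in> P" for g h
  proof
    assume "(g, h) \<in> (parcs (cayley_graph G S) \<inter> P \<times> P)\<^sup>*"
    then show "(g, h) \<in> rtrancl_on P (parcs (cayley_graph G S) \<inter> P \<times> P)"
      using that by (induction rule: rtrancl_induct) (auto intro: rtrancl_on_into_rtrancl_on)
  qed (rule rtrancl_on_rtranclI)
  ultimately show ?thesis
    by (simp add: connected_conv)
qed

lemma nonneg_connected_change_generators:
  fixes G (structure)
  assumes "group G" and phi: "\<phi> \<in> nonzero_characters G"
    and S: "finite_generating_set G S" and T: "finite_generating_set G T"
    and con: "nonneg_connected G S \<phi>"
  shows "nonneg_connected G T \<phi>"
proof -
  interpret group G by fact
  define R where "R c = parcs (cayley_graph G T) \<inter> {g \<in> carrier G. c \<le> \<phi> g} \<times> {g \<in> carrier G. c \<le> \<phi> g}"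
    for c :: real
  have hom: "\<phi> (g \<otimes> h) = \<phi> g + \<phi> h" if "g \<in> carrier G" "h \<in> carrier G" for g h
    using phi that by (auto simp: nonzero_characters_def hom_def real_group_def)
  have one: "\<phi> \<one> = 0"
    using hom[of \<one> \<one>] by simp
  have inv: "\<phi> (inv g) = - \<phi> g" if "g \<in> carrier G" for g
    using hom[of g "inv g"] that one by simp
  have Tc: "T \<subseteq> carrier G" "generate G T = carrier G" "finite T"
    and Sc: "S \<subseteq> carrier G" "generate G S = carrier G" "finite S"
    using S T by (auto simp: finite_generating_set_def)
  have symR: "(h, g) \<in> (R c)\<^sup>*" if "(g, h) \<in> (R c)\<^sup>*" for g h c
  proof -
    have "sym (R c)"
      by (auto simp: R_def cayley_graph_def sym_def)
    then show ?thesis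
      using that by (meson sym_rtrancl symD)
  qed
  have mono: "(g, h) \<in> (R d)\<^sup>*" if "(g, h) \<in> (R c)\<^sup>*" "d \<le> c" for g h c d
  proof -
    have "R c \<subseteq> R d"
      using that(2) by (auto simp: R_def)
    then show ?thesis
      using that(1) rtrancl_mono by blast
  qed
  have left: "(a \<otimes> g, a \<otimes> h) \<in> (R (c + \<phi> a))\<^sup>*" if "(g, h) \<in> (R c)\<^sup>*" "a \<in> carrier G" for a g h c
    using that(1)
  proof (induction rule: rtrancl_induct)
    case (step y z)
    have yz: "y \<in> carrier G" "z \<in> carrier G" "c \<le> \<phi> y" "c \<le> \<phi> z"
      using step(2) by (auto simp: R_def)
    from step(2) obtain t where t: "t \<in> T" "z = y \<otimes> t \<or> y = z \<otimes> t"
      by (auto simp: R_def cayley_graph_def)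
    have "t \<in> carrier G"
      using t Tc by auto
    then have "a \<otimes> z = a \<otimes> y \<otimes> t \<or> a \<otimes> y = a \<otimes> z \<otimes> t"
      using t yz that(2) by (auto simp: m_assoc)
    then have "(a \<otimes> y, a \<otimes> z) \<in> R (c + \<phi> a)"
      using yz that(2) t(1) by (auto simp: R_def cayley_graph_def hom)
    with step(3) show ?case
      by (rule rtrancl_into_rtrancl)
  qed simp
  have word: "\<exists>c\<le>0. (\<one>, g) \<in> (R c)\<^sup>*" if "g \<in> carrier G" for g
  proof -
    have "g \<in> generate G T"
      using that Tc by simp
    then show ?thesis
    proof (induction rule: generate.induct)
      case one
      then show ?case by auto
    next
      case (incl t)
      then have t: "t \<in> carrier G" "t \<in> T"
        using Tc by auto
      then have "(\<one>, t) \<in> parcs (cayley_graph G T)"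
        by (auto simp: cayley_graph_def intro!: bexI[of _ t])
      then have "(\<one>, t) \<in> R (min 0 (\<phi> t))"
        using t one by (auto simp: R_def)
      then show ?case
        by (intro exI[of _ "min 0 (\<phi> t)"]) auto
    next
      case (inv t)
      then have t: "t \<in> carrier G" "t \<in> T"
        using Tc by auto
      then have "(\<one>, inv t) \<in> parcs (cayley_graph G T)"
        by (auto simp: cayley_graph_def intro!: bexI[of _ t])
      then have "(\<one>, inv t) \<in> R (min 0 (\<phi> (inv t)))"
        using t one by (auto simp: R_def)
      then show ?case
        by (intro exI[of _ "min 0 (\<phi> (inv t))"]) auto
    next
      case (eng g h)
      then obtain c d where cd: "c \<le> 0" "(\<one>, g) \<in> (R c)\<^sup>*" "d \<le> 0" "(\<one>, h) \<in> (R d)\<^sup>*"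
        by auto
      have gh: "g \<in> carrier G" "h \<in> carrier G"
        using eng Tc by auto
      have "(g, g \<otimes> h) \<in> (R (d + \<phi> g))\<^sup>*"
        using left[OF cd(4) gh(1)] gh by simp
      then have "(\<one>, g \<otimes> h) \<in> (R (min c (d + \<phi> g)))\<^sup>*"
        using mono[OF cd(2), of "min c (d + \<phi> g)"] mono[of g "g \<otimes> h" _ "min c (d + \<phi> g)"]
        by (meson min.cobounded1 min.cobounded2 rtrancl_trans)
      then show ?case
        using cd(1) by (intro exI[of _ "min c (d + \<phi> g)"]) auto
    qed
  qed
  have "\<exists>C\<le>0. \<forall>s\<in>S. (\<one>, s) \<in> (R C)\<^sup>*"
    using Sc(3,1)
  proof (induction S rule: finite_induct)
    case empty
    then show ?case by auto
  next
    case (insert s S)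
    then obtain C where "C \<le> 0" "\<forall>s\<in>S. (\<one>, s) \<in> (R C)\<^sup>*"
      by auto
    moreover obtain c where "c \<le> 0" "(\<one>, s) \<in> (R c)\<^sup>*"
      using word insert.prems by auto
    ultimately show ?case
      by (intro exI[of _ "min c C"]) (auto intro: mono)
  qed
  then obtain C where C: "C \<le> 0" "\<And>s. s \<in> S \<Longrightarrow> (\<one>, s) \<in> (R C)\<^sup>*"
    by auto
  have "\<exists>t\<in>T. \<phi> t \<noteq> 0"
  proof (rule ccontr)
    assume *: "\<not> (\<exists>t\<in>T. \<phi> t \<noteq> 0)"
    have "\<phi> g = 0" if "g \<in> generate G T" for g
      using that
    proof (induction rule: generate.induct)
      case (eng g h)
      then show ?case using Tc by (simp add: hom)
    qed (use * Tc one inv in auto)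
    with phi Tc show False
      by (auto simp: nonzero_characters_def)
  qed
  then obtain t0 where t0: "t0 \<in> T" "\<phi> t0 \<noteq> 0" by auto
  define t where "t = (if \<phi> t0 > 0 then t0 else inv t0)"
  have t: "t \<in> carrier G" "\<phi> t > 0"
    using t0 Tc inv by (auto simp: t_def)
  have up1: "(\<one>, t) \<in> (R 0)\<^sup>*"
  proof -
    have "(\<one>, t) \<in> parcs (cayley_graph G T)"
      using t t0 Tc by (auto simp: t_def cayley_graph_def intro!: bexI[of _ t0])
    then show ?thesis
      using t one by (auto simp: R_def)
  qed
  have phi_pow: "\<phi> (t [^] (n::nat)) = n * \<phi> t" for n
    using t by (induction n) (auto simp: one hom algebra_simps)
  have up: "(\<one>, t [^] (n::nat)) \<in> (R 0)\<^sup>*" for n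
  proof (induction n)
    case (Suc n)
    have "(t [^] n \<otimes> \<one>, t [^] n \<otimes> t) \<in> (R (0 + \<phi> (t [^] n)))\<^sup>*"
      using left[OF up1] t by simp
    moreover have "0 \<le> 0 + \<phi> (t [^] n)"
      using t by (simp add: phi_pow)
    ultimately have "(t [^] n, t [^] Suc n) \<in> (R 0)\<^sup>*"
      using mono t by simp
    with Suc show ?case by simp
  qed simp
  obtain n :: nat where n: "real n * \<phi> t \<ge> - C"
    using reals_Archimedean3[OF t(2)] by (meson less_imp_le)
  define a where "a = t [^] n"
  have a: "a \<in> carrier G" "\<phi> a + C \<ge> 0" "(\<one>, a) \<in> (R 0)\<^sup>*" "\<phi> a \<ge> 0"
    using t n up by (auto simp: a_def phi_pow)
  let ?P = "{g \<in> carrier G. 0 \<le> \<phi> g}"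
  have coarse: "(g, h) \<in> (R C)\<^sup>*"
    if "(g, h) \<in> (parcs (cayley_graph G S) \<inter> ?P \<times> ?P)\<^sup>*" for g h
    using that
  proof (induction rule: rtrancl_induct)
    case (step y z)
    have yz: "y \<in> carrier G" "z \<in> carrier G" "0 \<le> \<phi> y" "0 \<le> \<phi> z"
      using step(2) by auto
    from step(2) obtain s where s: "s \<in> S" "z = y \<otimes> s \<or> y = z \<otimes> s"
      by (auto simp: cayley_graph_def)
    have sc: "s \<in> carrier G"
      using s Sc by auto
    have "(x, x \<otimes> s) \<in> (R C)\<^sup>*" if "x \<in> carrier G" "0 \<le> \<phi> x" for x
      using left[OF C(2)[OF s(1)] that(1)] that sc mono[of x "x \<otimes> s" "C + \<phi> x" C] by simp
    then have "(y, z) \<in> (R C)\<^sup>*"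
      using s(2) yz symR by auto
    with step(3) show ?case
      by (rule rtrancl_trans)
  qed simp
  have "(g, h) \<in> (R 0)\<^sup>*" if g: "g \<in> ?P" and h: "h \<in> ?P" for g h
  proof -
    have climb: "(x, x \<otimes> a) \<in> (R 0)\<^sup>*" if "x \<in> ?P" for x
      using left[OF a(3), of x] that a(1) mono[of x "x \<otimes> a" "0 + \<phi> x" 0] by simp
    have P: "inv a \<otimes> x \<otimes> a \<in> ?P" if "x \<in> ?P" for x
      using that a(1) by (simp add: hom inv)
    have "(inv a \<otimes> g \<otimes> a, inv a \<otimes> h \<otimes> a) \<in> (R C)\<^sup>*"
      using con P[OF g] P[OF h]
      by (intro coarse) (simp add: nonneg_connected_def cayley_reachable_iff)
    then have "(a \<otimes> (inv a \<otimes> g \<otimes> a), a \<otimes> (inv a \<otimes> h \<otimes> a)) \<in> (R (C + \<phi> a))\<^sup>*"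
      using a(1) by (rule left)
    moreover have "a \<otimes> (inv a \<otimes> x \<otimes> a) = x \<otimes> a" if "x \<in> ?P" for x
      using that a(1) by (simp add: m_assoc[symmetric])
    ultimately have "(g \<otimes> a, h \<otimes> a) \<in> (R 0)\<^sup>*"
      using g h a(2) mono[of "g \<otimes> a" "h \<otimes> a" "C + \<phi> a" 0] by simp
    then show ?thesis
      using climb[OF g] symR[OF climb[OF h]] by (meson rtrancl_trans)
  qed
  moreover have "\<one> \<in> ?P"
    using one by simp
  ultimately show ?thesis
    by (auto simp: nonneg_connected_def cayley_reachable_iff R_def)
qed

lemma bns_invariant_iff:
  assumes G: "group G" and S: "finite_generating_set G S" and phi: "\<phi> \<in> nonzero_characters G"
  shows "character_class G \<phi> \<in> bns_invariant G \<longleftrightarrow> nonneg_connected G S \<phi>"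
proof
  assume "character_class G \<phi> \<in> bns_invariant G"
  then obtain \<psi> T where psi: "character_class G \<phi> = character_class G \<psi>"
      "\<psi> \<in> nonzero_characters G" "finite_generating_set G T" "nonneg_connected G T \<psi>"
    by (auto simp: bns_invariant_def)
  have "\<phi> \<in> character_class G \<phi>"
    using phi by (auto simp: character_class_def nonzero_characters_def intro!: exI[of _ 1])
  then obtain r where r: "r > 0" "\<And>g. g \<in> carrier G \<Longrightarrow> \<phi> g = r * \<psi> g"
    unfolding psi(1) by (auto simp: character_class_def)
  have "{g \<in> carrier G. 0 \<le> \<phi> g} = {g \<in> carrier G. 0 \<le> \<psi> g}"
    using r by (auto simp: zero_le_mult_iff)
  then show "nonneg_connected G S \<phi>"
    using nonneg_connected_change_generators[OF G psi(2,3) S psi(4)]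
    by (simp add: nonneg_connected_def)
qed (use S phi in \<open>auto simp: bns_invariant_def\<close>)

definition dead_edge_subgraph :: "'v pair_pre_digraph \<Rightarrow> ('v word set \<Rightarrow> real) \<Rightarrow> 'v pair_pre_digraph"
where
  "dead_edge_subgraph \<Gamma> \<phi> =
     (let D = {e \<in> parcs \<Gamma>. \<phi> (edge_element \<Gamma> e) = 0}
      in \<lparr>pverts = fst ` D \<union> snd ` D, parcs = D\<rparr>)"

end

theory Submission
  imports Defs
begin

text \<open>
  A character \<open>\<phi>\<close> of \<open>BB\<close> takes the value \<open>f v - f u\<close> on the edge from \<open>u\<close> to \<open>v\<close>, for a
  function \<open>f\<close> on the vertices.  Simple connectivity enters only through the vanishing of the
  first simplicial cohomology: every additive function on the edges is a coboundary.

  If a full subgraph of the dead edge subgraph separates, then by cohomology so does a connected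
  one, on which \<open>f\<close> is constant.  Over its group \<open>BB\<close> splits as an amalgam, on whose amalgamated
  subgroup \<open>\<phi>\<close> vanishes, and this disconnects the half space \<open>{\<phi> \<ge> 0}\<close>.

  Conversely, if no such subgraph separates, cohomology shows that any two live edges are linked by
  a chain of live edges in which consecutive ones span a simplex and hence commute, and that the
  ends of each dead edge are joined by dead edges spanning a triangle with a live one.  Pushing
  paths along commuting generators then connects \<open>{\<phi> \<ge> 0}\<close>.
\<close>

subsection \<open>Cocycles on the flag complex of a graph\<close>

text \<open>All uses of cohomology follow one scheme. If some connectivity fails, an indicator
  function jumps. Its jumps along selected edges form a real cochain, and this is additive on
  triangles because no triangle can see both the jump and the place where it was cut off. A
  primitive of this cochain is constant on sets already known to be connected, and that contradicts
  the jump. So only real-valued functions on edges have to be integrated, never homotopies of edge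
  paths.

  A separating full subgraph may be disconnected, and \<open>f\<close> may then take different
  values on its components, whereas the splitting argument needs a single value on the whole
  separator. This forces the passage to a connected piece, which is itself a cohomological
  statement: two disjoint sets without edges between them cannot separate jointly unless one of them
  does so alone.

  For the converse, the basic move is that commuting elements \<open>g\<close> and \<open>h\<close>
  of positive value are joined inside \<open>{\<phi> > 0}\<close> through \<open>g h\<close>. This
  is why simplices of live edges are the relevant links.\<close>

definition cocycle :: "('v \<times> 'v) set \<Rightarrow> ('v \<Rightarrow> 'v \<Rightarrow> real) \<Rightarrow> bool" where
  "cocycle E c \<longleftrightarrow> (\<forall>u v. (u, v) \<in> E \<longrightarrow> c v u = - c u v) \<and>
     (\<forall>u v w. (u, v) \<in> E \<longrightarrow> (v, w) \<in> E \<longrightarrow> (u, w) \<in> E \<longrightarrow> c u w = c u v + c v w)"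

definition coboundary :: "('v \<times> 'v) set \<Rightarrow> ('v \<Rightarrow> 'v \<Rightarrow> real) \<Rightarrow> bool" where
  "coboundary E c \<longleftrightarrow> (\<exists>h. \<forall>(u, v)\<in>E. c u v = h v - h u)"

text \<open>Discrete homotopy invariance of line integrals: both ways around a unit square give the
  same sum, so consecutive rows differ by a telescoping sum of vertical steps, whose end terms
  cancel because every row closes up.\<close>

lemma grid_sum_eq:
  fixes d :: "'a \<Rightarrow> 'a \<Rightarrow> 'b::ab_group_add" and a :: "nat \<Rightarrow> nat \<Rightarrow> 'a"
  assumes "\<And>i j. i < m \<Longrightarrow> j < n \<Longrightarrow>
      d (a i j) (a i (Suc j)) + d (a i (Suc j)) (a (Suc i) (Suc j)) =
      d (a i j) (a (Suc i) j) + d (a (Suc i) j) (a (Suc i) (Suc j))"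
    and "\<And>i. i \<le> m \<Longrightarrow> a i n = a i 0"
  shows "(\<Sum>j<n. d (a 0 j) (a 0 (Suc j))) = (\<Sum>j<n. d (a m j) (a m (Suc j)))"
  using assms
proof (induction m)
  case (Suc m)
  have "(\<Sum>j<n. d (a m j) (a m (Suc j))) - (\<Sum>j<n. d (a (Suc m) j) (a (Suc m) (Suc j))) =
      (\<Sum>j<n. d (a m j) (a (Suc m) j) - d (a m (Suc j)) (a (Suc m) (Suc j)))"
    unfolding sum_subtractf[symmetric]
  proof (intro sum.cong HOL.refl)
    fix j assume "j \<in> {..<n}"
    then show "d (a m j) (a m (Suc j)) - d (a (Suc m) j) (a (Suc m) (Suc j)) =
        d (a m j) (a (Suc m) j) - d (a m (Suc j)) (a (Suc m) (Suc j))"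
      using Suc.prems(1)[of m j] by (simp add: algebra_simps)
  qed
  also have "\<dots> = d (a m 0) (a (Suc m) 0) - d (a m n) (a (Suc m) n)"
    by (rule sum_lessThan_telescope')
  also have "\<dots> = 0"
    using Suc.prems(2)[of m] Suc.prems(2)[of "Suc m"] by simp
  finally show ?case
    using Suc by simp
qed simp

lemma barycentric_large_coordinate:
  assumes "finite V" "{v. x v \<noteq> 0} \<subseteq> V" "(\<Sum>v | x v \<noteq> 0. x v) = (1::real)"
  shows "\<exists>v\<in>V. 1 / card V \<le> x v"
proof (rule ccontr)
  assume "\<not> ?thesis"
  then have *: "x v < 1 / card V" if "v \<in> V" for v
    using that by (meson not_le)
  have "V \<noteq> {}"
    using assms by auto
  then have "sum x V < (\<Sum>v\<in>V. 1 / card V)"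
    using assms(1) * by (intro sum_strict_mono) auto
  also have "\<dots> = 1"
    using assms(1) \<open>V \<noteq> {}\<close> by simp
  finally have "sum x V < 1" .
  moreover have "sum x V = (\<Sum>v | x v \<noteq> 0. x v)"
    using assms by (intro sum.mono_neutral_right) auto
  ultimately show False
    using assms(3) by simp
qed

text \<open>Finitely many coordinates matter, so their separate moduli of uniform continuity have a
  positive minimum; no metric on the function space is involved.\<close>

lemma uniformly_continuous_coordinates:
  fixes h :: "'a::metric_space \<Rightarrow> 'v \<Rightarrow> real"
  assumes "compact Q" "continuous_on Q h" "finite V" "0 < \<epsilon>"
  obtains \<delta> where "0 < \<delta>"
    "\<And>y z v. y \<in> Q \<Longrightarrow> z \<in> Q \<Longrightarrow> dist y z < \<delta> \<Longrightarrow> v \<in> V \<Longrightarrow> \<bar>h y v - h z v\<bar> < \<epsilon>"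
proof -
  have "\<exists>\<delta>>0. \<forall>v\<in>V. \<forall>y\<in>Q. \<forall>z\<in>Q. dist y z < \<delta> \<longrightarrow> \<bar>h y v - h z v\<bar> < \<epsilon>"
    using assms(3)
  proof (induction V rule: finite_induct)
    case empty
    show ?case by (intro exI[of _ 1]) simp
  next
    case (insert v V)
    then obtain \<delta> where \<delta>: "\<delta> > 0"
        "\<And>v y z. v \<in> V \<Longrightarrow> y \<in> Q \<Longrightarrow> z \<in> Q \<Longrightarrow> dist y z < \<delta> \<Longrightarrow> \<bar>h y v - h z v\<bar> < \<epsilon>"
      by blast
    have "continuous_on Q (\<lambda>z. h z v)"
      using assms(2) by (rule continuous_on_product_then_coordinatewise)
    then have "uniformly_continuous_on Q (\<lambda>z. h z v)"
      using assms(1) by (rule compact_uniformly_continuous)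
    then obtain \<delta>' where \<delta>': "\<delta>' > 0" "\<And>y z. y \<in> Q \<Longrightarrow> z \<in> Q \<Longrightarrow> dist y z < \<delta>' \<Longrightarrow> \<bar>h y v - h z v\<bar> < \<epsilon>"
      using assms(4) unfolding uniformly_continuous_on_def dist_real_def by (metis dist_commute)
    show ?case
      using \<delta> \<delta>' by (intro exI[of _ "min \<delta> \<delta>'"]) auto
  qed
  then show ?thesis
    using that by blast
qed

text \<open>
  A null homotopy of the loop is sampled on a grid so fine that the vertices with large
  barycentric coordinates at the corners of each small square span a simplex.
\<close>

lemma cocycle_loop_sum:
  fixes \<Gamma> :: "'v pair_pre_digraph" and c :: "'v \<Rightarrow> 'v \<Rightarrow> real"
  assumes \<Gamma>: "pair_graph \<Gamma>"
    and sc: "simply_connected (geometric_realization (flag_complex \<Gamma>))"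
    and coc: "cocycle (parcs \<Gamma>) c"
    and p: "\<And>i. i < n \<Longrightarrow> (p i, p (Suc i)) \<in> parcs \<Gamma>" "p n = p 0" and "n > 0"
  shows "(\<Sum>i<n. c (p i) (p (Suc i))) = 0"
proof -
  interpret pair_graph \<Gamma> by fact
  define V where "V = pverts \<Gamma>"
  define E where "E = parcs \<Gamma>"
  have finV: "finite V"
    unfolding V_def by (rule pair_finite_verts)
  have EV: "u \<in> V" "v \<in> V" if "(u, v) \<in> E" for u v
    using that by (auto simp: E_def V_def dest: in_arcsD1 in_arcsD2)
  have symE: "(v, u) \<in> E" if "(u, v) \<in> E" for u v
    using that pair_sym_arcs by (auto simp: E_def symmetric_def sym_def)
  have irr: "u \<noteq> v" if "(u, v) \<in> E" for u v
    using that pair_no_loops by (force simp: E_def)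
  \<comment> \<open>Neighbouring sample points may select the same vertex. So \<open>rel\<close>
    admits equality, and \<open>d\<close> vanishes on degenerate edges, which keeps additivity valid
    on degenerate triangles.\<close>
  define rel where "rel x y \<longleftrightarrow> x \<in> V \<and> y \<in> V \<and> (x = y \<or> (x, y) \<in> E)" for x y
  define d where "d x y = (if x = y then 0 else c x y)" for x y
  have c_swap: "c v u = - c u v" if "(u, v) \<in> E" for u v
    using coc that by (simp add: cocycle_def E_def)
  have c_add: "c u w = c u v + c v w" if "(u, v) \<in> E" "(v, w) \<in> E" "(u, w) \<in> E" for u v w
    using coc that unfolding cocycle_def E_def by blast
  have d_add: "d x z = d x y + d y z" if "rel x y" "rel y z" "rel x z" for x y z
  proof (cases "x = y \<or> y = z")
    case False
    then have "(x, y) \<in> E" "(y, z) \<in> E" "x = z \<or> (x, z) \<in> E"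
      using that by (auto simp: rel_def)
    then show ?thesis
      using False c_swap[of x y] c_add[of x y z] by (auto simp: d_def)
  qed (auto simp: d_def)
  define S where "S = geometric_realization (flag_complex \<Gamma>)"
  have S_rel: "rel v w" if "x \<in> S" "x v \<noteq> 0" "x w \<noteq> 0" for x v w
    using that unfolding S_def geometric_realization_def flag_complex_def rel_def V_def E_def
    by auto
  have S_big: "\<exists>v\<in>V. 1 / card V \<le> x v" if "x \<in> S" for x
    using that finV
    by (intro barycentric_large_coordinate)
      (auto simp: S_def geometric_realization_def flag_complex_def V_def)

  define seg where "seg i r = (\<lambda>v. (if p i = v then 1 - r else 0) + (if p (Suc i) = v then r else 0))"
    for i and r :: real
  \<comment> \<open>Hat functions centred at \<open>i / n\<close>, indexed by the steps of the loop,
    so that a vertex visited repeatedly collects several hats. For \<open>n * t\<close> between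
    \<open>i\<close> and \<open>i + 1\<close> only two of them survive, and the loop runs along
    \<open>seg i\<close>.\<close>
  define \<gamma> where "\<gamma> t = (\<lambda>v. \<Sum>i\<le>n. if p i = v then max 0 (1 - \<bar>n * t - i\<bar>) else 0)" for t :: real
  have \<gamma>_seg: "\<gamma> t = seg i r" if "n * t = i + r" "0 \<le> r" "r \<le> 1" "i < n" for t r :: real and i
  proof
    fix v
    have "\<gamma> t v = (\<Sum>j\<in>{i, Suc i}. if p j = v then max 0 (1 - \<bar>n * t - j\<bar>) else 0)"
      unfolding \<gamma>_def
    proof (rule sum.mono_neutral_right)
      show "\<forall>j\<in>{..n} - {i, Suc i}. (if p j = v then max 0 (1 - \<bar>n * t - j\<bar>) else 0) = 0"
      proof
        fix j assume "j \<in> {..n} - {i, Suc i}"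
        then consider "j + 1 \<le> i" | "i + 2 \<le> j"
          by fastforce
        then have "real j + 1 \<le> i \<or> real i + 2 \<le> j"
          by cases linarith+
        then show "(if p j = v then max 0 (1 - \<bar>n * t - j\<bar>) else 0) = 0"
          using that by auto
      qed
    qed (use that in auto)
    also have "\<dots> = seg i r v"
      using that by (auto simp: seg_def)
    finally show "\<gamma> t v = seg i r v" .
  qed
  have seg_S: "seg i r \<in> S" if "0 \<le> r" "r \<le> 1" "i < n" for i r
  proof -
    have e: "(p i, p (Suc i)) \<in> E"
      using p(1) that by (simp add: E_def)
    have sub: "{v. seg i r v \<noteq> 0} \<subseteq> {p i, p (Suc i)}"
      by (auto simp: seg_def split: if_splits)
    have "(\<Sum>v | seg i r v \<noteq> 0. seg i r v) = (\<Sum>v\<in>{p i, p (Suc i)}. seg i r v)"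
      using sub by (intro sum.mono_neutral_left) auto
    also have "\<dots> = 1"
      using irr[OF e] by (simp add: seg_def)
    finally have s1: "(\<Sum>v | seg i r v \<noteq> 0. seg i r v) = 1" .
    then have ne: "{v. seg i r v \<noteq> 0} \<noteq> {}"
      by (metis sum.empty zero_neq_one)
    have "{v. seg i r v \<noteq> 0} \<in> flag_complex \<Gamma>"
    proof -
      have "finite {v. seg i r v \<noteq> 0}"
        using sub finite_subset by fastforce
      moreover have "{v. seg i r v \<noteq> 0} \<subseteq> V"
        using sub EV[OF e] by auto
      moreover have "(u, v) \<in> E" if "seg i r u \<noteq> 0" "seg i r v \<noteq> 0" "u \<noteq> v" for u v
        using that sub e symE[OF e] by auto
      ultimately show ?thesis
        using ne unfolding flag_complex_def V_def E_def by blast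
    qed
    then show ?thesis
      using s1 that unfolding S_def geometric_realization_def by (auto simp: seg_def)
  qed
  have loc: "\<exists>i r. n * t = real i + r \<and> 0 \<le> r \<and> r \<le> 1 \<and> i < n" if "0 \<le> t" "t \<le> 1" for t :: real
  proof (cases "t = 1")
    \<comment> \<open>At the end point the floor of \<open>n * t\<close> is \<open>n\<close>, one
      past the last edge; the last edge with parameter 1 takes its place.\<close>
    case True
    then show ?thesis
      using \<open>n > 0\<close> by (intro exI[of _ "n - 1"] exI[of _ 1]) (auto simp: of_nat_diff)
  next
    case False
    have "n * t < n"
      using that False \<open>n > 0\<close> by simp
    moreover have "0 \<le> n * t"
      using that by simp
    ultimately have "nat \<lfloor>n * t\<rfloor> < n"
      by (simp add: floor_less_iff nat_less_iff)
    moreover have "real (nat \<lfloor>n * t\<rfloor>) \<le> n * t" "n * t \<le> real (nat \<lfloor>n * t\<rfloor>) + 1"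
      using \<open>0 \<le> n * t\<close> by linarith+
    ultimately show ?thesis
      by (intro exI[of _ "nat \<lfloor>n * t\<rfloor>"] exI[of _ "n * t - nat \<lfloor>n * t\<rfloor>"]) linarith
  qed
  have \<gamma>_S: "\<gamma> t \<in> S" if "0 \<le> t" "t \<le> 1" for t
    using loc[OF that] \<gamma>_seg seg_S by metis
  have ends: "\<gamma> 1 = \<gamma> 0"
  proof -
    have "\<gamma> 1 = seg (n - 1) 1"
      using \<open>n > 0\<close> by (intro \<gamma>_seg) (auto simp: of_nat_diff)
    also have "\<dots> = seg 0 0"
      using \<open>n > 0\<close> p(2) by (auto simp: seg_def fun_eq_iff)
    also have "\<dots> = \<gamma> 0"
      using \<open>n > 0\<close> by (intro \<gamma>_seg[symmetric]) auto
    finally show ?thesis .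
  qed
  have "continuous_on {0..1} (\<lambda>t::real. if p i = v then max 0 (1 - \<bar>n * t - real i\<bar>) else 0)" for i v
    by (cases "p i = v") (auto intro!: continuous_intros)
  then have "continuous_on {0..1} \<gamma>"
    unfolding \<gamma>_def by (intro continuous_on_coordinatewise_then_product continuous_on_sum)
  then have "homotopic_loops S \<gamma> (\<lambda>_. \<gamma> 0)"
    using ends \<gamma>_S
    by (intro sc[folded S_def, unfolded simply_connected_def, rule_format])
      (auto simp: path_def path_image_def pathstart_def pathfinish_def)
  then obtain h where h: "continuous_on ({0..1::real} \<times> {0..1}) h"
      "h \<in> ({0..1} \<times> {0..1}) \<rightarrow> S"
      "\<And>t. t \<in> {0..1} \<Longrightarrow> h (0, t) = \<gamma> t" "\<And>t. t \<in> {0..1} \<Longrightarrow> h (1, t) = \<gamma> 0"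
      "\<And>s. s \<in> {0..1} \<Longrightarrow> h (s, 1) = h (s, 0)"
    unfolding homotopic_loops pathstart_def pathfinish_def o_def by (elim exE conjE) blast
  define Q where "Q = {0..1::real} \<times> {0..1::real}"
  have "compact Q"
    by (simp add: Q_def compact_Times)
  have hS: "h z \<in> S" if "z \<in> Q" for z
    using h(2) that by (auto simp: Q_def)
  have "V \<noteq> {}"
    using p(1) \<open>n > 0\<close> EV by (auto simp: E_def)
  then have "0 < 1 / real (card V)"
    using finV by (simp add: card_gt_0_iff)
  then obtain \<delta> where \<delta>: "\<delta> > 0"
      "\<And>y z v. y \<in> Q \<Longrightarrow> z \<in> Q \<Longrightarrow> dist y z < \<delta> \<Longrightarrow> v \<in> V \<Longrightarrow> \<bar>h y v - h z v\<bar> < 1 / card V"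
    using uniformly_continuous_coordinates[OF \<open>compact Q\<close> h(1)[folded Q_def] finV] by metis
  define w where "w x = (SOME v. v \<in> V \<and> 1 / card V \<le> x v)" for x :: "'v \<Rightarrow> real"
  have w: "w x \<in> V" "1 / card V \<le> x (w x)" if "x \<in> S" for x
    using someI_ex[OF S_big[OF that, unfolded Bex_def]] by (auto simp: w_def)
  have w_nz: "x (w x) \<noteq> 0" if "x \<in> S" for x
    using w(2)[OF that] \<open>0 < 1 / real (card V)\<close> by linarith
  \<comment> \<open>Coordinates of \<delta>-close points differ by less than
    \<open>1 / card V\<close>, so the vertex selected at \<open>y\<close> still has a nonzero
    coordinate at \<open>z\<close>. Both selected vertices thus lie in the support of
    \<open>h z\<close>, which is a simplex.\<close>
  have w_rel: "rel (w (h y)) (w (h z))" if "y \<in> Q" "z \<in> Q" "dist y z < \<delta>" for y z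
  proof -
    have "h z (w (h y)) \<noteq> 0"
      using \<delta>(2)[OF that] w[OF hS[OF that(1)]] by fastforce
    then show ?thesis
      using S_rel hS that(2) w_nz by blast
  qed
  obtain k :: nat where k: "k > 0" "2 / \<delta> < k"
    using reals_Archimedean2[of "2 / \<delta>"] \<delta>(1) by (metis less_trans divide_pos_pos zero_less_numeral of_nat_0_less_iff)
  \<comment> \<open>A multiple of \<open>n\<close>, so that the vertices of the loop are grid points
    and each of its edges is cut into \<open>k\<close> pieces.\<close>
  define m where "m = n * k"
  have "m > 0"
    using k \<open>n > 0\<close> by (simp add: m_def)
  have "k \<le> m"
    using \<open>n > 0\<close> by (simp add: m_def)
  then have "2 / \<delta> < m"
    using k by linarith
  then have mesh: "2 / m < \<delta>"
    using \<open>m > 0\<close> \<delta>(1) by (simp add: field_simps)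
  define z where "z i j = (real i / m, real j / m)" for i j
  have zQ: "z i j \<in> Q" if "i \<le> m" "j \<le> m" for i j
    using that \<open>m > 0\<close> by (auto simp: z_def Q_def)
  define a where "a i j = w (h (z i j))" for i j
  have a_rel: "rel (a i j) (a i' j')"
    if "i \<le> m" "j \<le> m" "i' \<le> m" "j' \<le> m" "i' \<in> {i, Suc i}" "j' \<in> {j, Suc j}" for i j i' j'
  proof -
    have "dist (z i j) (z i' j') \<le> \<bar>real i / m - real i' / m\<bar> + \<bar>real j / m - real j' / m\<bar>"
      unfolding z_def dist_Pair_Pair dist_real_def using sqrt_sum_squares_le_sum_abs by fastforce
    also have "\<dots> = (\<bar>real i - real i'\<bar> + \<bar>real j - real j'\<bar>) / m"
      by (simp add: diff_divide_distrib[symmetric] add_divide_distrib)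
    also have "\<dots> \<le> 2 / m"
      using that by (intro divide_right_mono) auto
    finally show ?thesis
      using mesh that unfolding a_def by (intro w_rel zQ) auto
  qed
  have "(\<Sum>j<m. d (a 0 j) (a 0 (Suc j))) = (\<Sum>j<m. d (a m j) (a m (Suc j)))"
  proof (rule grid_sum_eq[where d = d and a = a])
    fix i j assume "i < m" "j < m"
    then show "d (a i j) (a i (Suc j)) + d (a i (Suc j)) (a (Suc i) (Suc j)) =
      d (a i j) (a (Suc i) j) + d (a (Suc i) j) (a (Suc i) (Suc j))"
      using d_add[of "a i j" "a i (Suc j)" "a (Suc i) (Suc j)"]
        d_add[of "a i j" "a (Suc i) j" "a (Suc i) (Suc j)"] a_rel by simp
  next
    fix i assume "i \<le> m"
    then show "a i m = a i 0"
      using h(5)[of "real i / m"] \<open>m > 0\<close> by (simp add: a_def z_def)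
  qed
  also have "\<dots> = 0"
  proof -
    have "a m j = w (\<gamma> 0)" if "j \<le> m" for j
      using h(4)[of "real j / m"] that \<open>m > 0\<close> by (simp add: a_def z_def)
    then show ?thesis
      by (simp add: d_def)
  qed
  finally have 0: "(\<Sum>j<m. d (a 0 j) (a 0 (Suc j))) = 0" .
  \<comment> \<open>The support of a point on the \<open>i\<close>-th edge is contained in the two
    ends, and at an end it is a single vertex, so the selection is forced there.\<close>
  have a0: "a 0 (i * k + r) \<in> {p i, p (Suc i)}" "r = 0 \<Longrightarrow> a 0 (i * k + r) = p i"
      "r = k \<Longrightarrow> a 0 (i * k + r) = p (Suc i)"
    if "i < n" "r \<le> k" for i r
  proof -
    have "Suc i * k \<le> n * k"
      using that(1) by (intro mult_le_mono1) simp
    then have le: "i * k + r \<le> m"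
      using that(2) by (simp add: m_def)
    then have t: "real (i * k + r) / m \<in> {0..1}"
      using \<open>m > 0\<close> by (simp add: divide_le_eq_1 flip: of_nat_add of_nat_mult)
    have "h (z 0 (i * k + r)) = \<gamma> (real (i * k + r) / m)"
      using h(3)[OF t] by (simp add: z_def)
    also have "\<dots> = seg i (real r / k)"
      using that k \<open>n > 0\<close> by (intro \<gamma>_seg) (auto simp: m_def field_simps)
    finally have hz: "h (z 0 (i * k + r)) = seg i (real r / k)" .
    have nz: "seg i (real r / k) (a 0 (i * k + r)) \<noteq> 0"
      using w_nz[OF hS[OF zQ[of 0, OF _ le]]] hz by (simp add: a_def)
    then show "a 0 (i * k + r) \<in> {p i, p (Suc i)}" "r = 0 \<Longrightarrow> a 0 (i * k + r) = p i"
      "r = k \<Longrightarrow> a 0 (i * k + r) = p (Suc i)"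
      using k by (auto simp: seg_def split: if_splits)
  qed
  have block: "(\<Sum>j\<in>{i * k..<i * k + k}. d (a 0 j) (a 0 (Suc j))) = c (p i) (p (Suc i))" if "i < n" for i
  proof -
    have e: "(p i, p (Suc i)) \<in> E"
      using p(1) that by (simp add: E_def)
    \<comment> \<open>The selected vertices may jump back and forth between the two ends. Measured
      from \<open>p i\<close> the steps telescope, and only the first and the last sample
      count.\<close>
    define g where "g r = d (p i) (a 0 (i * k + r))" for r
    have "(\<Sum>j\<in>{i * k..<i * k + k}. d (a 0 j) (a 0 (Suc j))) = (\<Sum>r<k. g (Suc r) - g r)"
    proof -
      have "(\<Sum>j\<in>{i * k..<i * k + k}. d (a 0 j) (a 0 (Suc j))) =
          (\<Sum>r<k. d (a 0 (i * k + r)) (a 0 (i * k + Suc r)))"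
        using sum.shift_bounds_nat_ivl[of "\<lambda>j. d (a 0 j) (a 0 (Suc j))" 0 "i * k" k]
        by (simp add: add.commute lessThan_atLeast0)
      also have "\<dots> = (\<Sum>r<k. g (Suc r) - g r)"
      proof (rule sum.cong)
        fix r assume "r \<in> {..<k}"
        then have "a 0 (i * k + r) \<in> {p i, p (Suc i)}" "a 0 (i * k + Suc r) \<in> {p i, p (Suc i)}"
          by (intro a0 that; simp)+
        then have "d (p i) (a 0 (i * k + Suc r)) =
            d (p i) (a 0 (i * k + r)) + d (a 0 (i * k + r)) (a 0 (i * k + Suc r))"
          using e EV[OF e] symE[OF e] by (intro d_add) (auto simp: rel_def)
        then show "d (a 0 (i * k + r)) (a 0 (i * k + Suc r)) = g (Suc r) - g r"
          by (simp add: g_def)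
      qed simp
      finally show ?thesis .
    qed
    also have "\<dots> = g k - g 0"
      by (rule sum_lessThan_telescope)
    also have "\<dots> = c (p i) (p (Suc i))"
      using a0(2)[OF that, of 0] a0(3)[OF that, of k] irr[OF e] by (simp add: g_def d_def)
    finally show ?thesis .
  qed
  have "(\<Sum>j<m. d (a 0 j) (a 0 (Suc j))) = (\<Sum>i<n. c (p i) (p (Suc i)))"
    unfolding m_def using sum.nat_group[of "\<lambda>j. d (a 0 j) (a 0 (Suc j))" k n] block by simp
  with 0 show ?thesis
    by simp
qed

section \<open>Integration of cochains along walks\<close>

inductive walk_sum :: "('v \<times> 'v) set \<Rightarrow> ('v \<Rightarrow> 'v \<Rightarrow> real) \<Rightarrow> 'v \<Rightarrow> 'v \<Rightarrow> real \<Rightarrow> bool" for E c where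
  walk_sum_refl: "walk_sum E c u u 0"
| walk_sum_step: "walk_sum E c u v s \<Longrightarrow> (v, w) \<in> E \<Longrightarrow> walk_sum E c u w (s + c v w)"

lemma walk_sum_trans:
  assumes "walk_sum E c v w t" "walk_sum E c u v s"
  shows "walk_sum E c u w (s + t)"
  using assms
proof (induction rule: walk_sum.induct)
  case (walk_sum_step v w' t w)
  then show ?case
    using walk_sum.walk_sum_step[of E c u w' "s + t" w] by (simp add: add.assoc)
qed simp

lemma walk_sum_sym:
  assumes "walk_sum E c u v s" "\<And>x y. (x, y) \<in> E \<Longrightarrow> (y, x) \<in> E \<and> c y x = - c x y"
  shows "walk_sum E c v u (- s)"
  using assms(1)
proof (induction rule: walk_sum.induct)
  case (walk_sum_step u v s w)
  have "walk_sum E c w v (0 + c w v)"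
    using walk_sum_step assms(2) by (intro walk_sum.intros) blast
  then have "walk_sum E c w v (- c v w)"
    using assms(2)[OF walk_sum_step(2)] by simp
  with walk_sum_step.IH have "walk_sum E c w u (- c v w + - s)"
    by (rule walk_sum_trans)
  moreover have "- c v w + - s = - (s + c v w)"
    by simp
  ultimately show ?case
    by (simp only:)
qed (simp add: walk_sum.walk_sum_refl)

lemma walk_sum_imp_sequence:
  assumes "walk_sum E c u v s"
  obtains n p where "p 0 = u" "p n = v" "\<And>i. i < n \<Longrightarrow> (p i, p (Suc i)) \<in> E"
    "s = (\<Sum>i<n. c (p i) (p (Suc i)))"
proof -
  have "\<exists>n p. p 0 = u \<and> p n = v \<and> (\<forall>i<n. (p i, p (Suc i)) \<in> E) \<and> s = (\<Sum>i<n. c (p i) (p (Suc i)))"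
    using assms
  proof (induction rule: walk_sum.induct)
    case (walk_sum_refl u)
    then show ?case
      by (intro exI[of _ 0] exI[of _ "\<lambda>_. u"]) simp
  next
    case (walk_sum_step u v s w)
    then obtain n p where p: "p 0 = u" "p n = v" "\<forall>i<n. (p i, p (Suc i)) \<in> E"
        "s = (\<Sum>i<n. c (p i) (p (Suc i)))"
      by blast
    define q where "q = p(Suc n := w)"
    have q: "q i = p i" if "i \<le> n" for i
      using that by (simp add: q_def)
    have "(\<Sum>i<n. c (q i) (q (Suc i))) = s"
      unfolding p(4) by (intro sum.cong) (auto simp: q)
    then have "s + c v w = (\<Sum>i<Suc n. c (q i) (q (Suc i)))"
      using p(2) by (simp add: q) (simp add: q_def)
    moreover have "(q i, q (Suc i)) \<in> E" if "i < Suc n" for i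
      using that p(2,3) walk_sum_step(2) q[of i] q[of "Suc i"]
      by (cases "i = n") (auto simp: q_def)
    moreover have "q 0 = u" "q (Suc n) = w"
      using p(1) by (simp_all add: q_def)
    ultimately show ?case
      by blast
  qed
  then show ?thesis
    using that by blast
qed

text \<open>The primitive is the integral of \<open>c\<close> from a base vertex; two walks to the
  same vertex close up to a loop of integral zero, so the choice of walk is immaterial. The empty
  graph has no base vertex and is treated apart.\<close>

lemma simply_connected_imp_coboundary:
  fixes \<Gamma> :: "'v pair_pre_digraph"
  assumes \<Gamma>: "pair_graph \<Gamma>"
    and sc: "simply_connected (geometric_realization (flag_complex \<Gamma>))"
    and con: "\<And>u v. u \<in> pverts \<Gamma> \<Longrightarrow> v \<in> pverts \<Gamma> \<Longrightarrow> (u, v) \<in> (parcs \<Gamma>)\<^sup>*"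
    and coc: "cocycle (parcs \<Gamma>) c"
  shows "coboundary (parcs \<Gamma>) c"
proof (cases "pverts \<Gamma> = {}")
  interpret pair_graph \<Gamma> by fact
  case True
  then have "parcs \<Gamma> = {}"
    using in_arcsD1 by auto
  then show ?thesis
    by (simp add: coboundary_def)
next
  interpret pair_graph \<Gamma> by fact
  case False
  then obtain v0 where v0: "v0 \<in> pverts \<Gamma>"
    by blast
  have E: "(y, x) \<in> parcs \<Gamma> \<and> c y x = - c x y" if "(x, y) \<in> parcs \<Gamma>" for x y
  proof
    show "(y, x) \<in> parcs \<Gamma>"
      using that pair_sym_arcs by (auto simp: symmetric_def sym_def)
    show "c y x = - c x y"
      using that coc unfolding cocycle_def by blast
  qed
  have loop: "s = 0" if "walk_sum (parcs \<Gamma>) c u u s" for u s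
    using that
  proof (rule walk_sum_imp_sequence)
    fix n p
    assume p: "p 0 = u" "p n = u" "\<And>i. i < n \<Longrightarrow> (p i, p (Suc i)) \<in> parcs \<Gamma>"
      "s = (\<Sum>i<n. c (p i) (p (Suc i)))"
    show "s = 0"
    proof (cases "n = 0")
      case False
      then show ?thesis
        unfolding p(4) using p(1-3) by (intro cocycle_loop_sum[OF \<Gamma> sc coc]) auto
    qed (use p in simp)
  qed
  define h where "h v = (SOME s. walk_sum (parcs \<Gamma>) c v0 v s)" for v
  have h: "walk_sum (parcs \<Gamma>) c v0 v (h v)" if "v \<in> pverts \<Gamma>" for v
  proof -
    have "\<exists>s. walk_sum (parcs \<Gamma>) c v0 v s"
      using con[OF v0 that] by (induction rule: rtrancl_induct) (blast intro: walk_sum.intros)+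
    then show ?thesis
      unfolding h_def by (rule someI_ex)
  qed
  have "c u v = h v - h u" if "(u, v) \<in> parcs \<Gamma>" for u v
  proof -
    have "walk_sum (parcs \<Gamma>) c v0 v (h u + c u v)"
      using h[OF in_arcsD1[OF that]] that by (rule walk_sum_step)
    moreover have "walk_sum (parcs \<Gamma>) c v v0 (- h v)"
      using h[OF in_arcsD2[OF that]] E by (rule walk_sum_sym)
    ultimately have "walk_sum (parcs \<Gamma>) c v0 v0 (h u + c u v + - h v)"
      by (metis walk_sum_trans)
    then show ?thesis
      using loop by fastforce
  qed
  then show ?thesis
    by (auto simp: coboundary_def)
qed

subsection \<open>Separating sets and level sets\<close>

text \<open>True of the empty set, so that for induced subgraphs its negation is exactly
  \<open>disconnected_graph\<close>.\<close>

definition connected_on :: "('v \<times> 'v) set \<Rightarrow> 'v set \<Rightarrow> bool" where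
  "connected_on E W \<longleftrightarrow> (\<forall>u\<in>W. \<forall>v\<in>W. (u, v) \<in> (E \<inter> W \<times> W)\<^sup>*)"

lemma rtrancl_invariant:
  assumes "(u, v) \<in> R\<^sup>*" "\<And>x y. (x, y) \<in> R \<Longrightarrow> h x = h y"
  shows "h u = h v"
  using assms(1) by (induction rule: rtrancl_induct) (auto dest: assms(2))

lemma connected_on_invariant:
  assumes "connected_on E W" "u \<in> W" "v \<in> W"
    and "\<And>x y. (x, y) \<in> E \<Longrightarrow> x \<in> W \<Longrightarrow> y \<in> W \<Longrightarrow> h x = h y"
  shows "h u = h v"
  by (rule rtrancl_invariant[of _ _ "E \<inter> W \<times> W"]) (use assms in \<open>auto simp: connected_on_def\<close>)

locale acyclic_graph =
  fixes V :: "'v set" and E :: "('v \<times> 'v) set"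
  assumes finite_V: "finite V"
    and E_sym: "(u, v) \<in> E \<Longrightarrow> (v, u) \<in> E"
    and E_irrefl: "(u, u) \<notin> E"
    and E_V: "(u, v) \<in> E \<Longrightarrow> u \<in> V"
    and E_connected: "connected_on E V"
    and cocycle_imp_coboundary: "cocycle E c \<Longrightarrow> coboundary E c"
begin

lemma E_V': "(u, v) \<in> E \<Longrightarrow> v \<in> V"
  using E_V E_sym by blast

lemma cocycleE:
  assumes "\<And>u v. (u, v) \<in> E \<Longrightarrow> c v u = - c u v"
    and "\<And>u v w. (u, v) \<in> E \<Longrightarrow> (v, w) \<in> E \<Longrightarrow> (u, w) \<in> E \<Longrightarrow> c u w = c u v + c v w"
  obtains h where "\<And>u v. (u, v) \<in> E \<Longrightarrow> c u v = h v - (h u :: real)"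
  using cocycle_imp_coboundary[of c] assms unfolding cocycle_def coboundary_def by blast

text \<open>A Mayer-Vietoris argument. A triangle meeting \<open>C\<close> misses \<open>D\<close>,
  so the coboundary of the indicator of a component \<open>A\<close> of the complement remains a
  cocycle when cut down to the edges touching \<open>C\<close>. Its primitive \<open>h\<close> is
  constant off \<open>C\<close>, and \<open>h\<close> minus the indicator is constant off
  \<open>D\<close>; hence the indicator cannot tell \<open>a\<close> from \<open>b\<close>.\<close>

lemma connected_on_minus_Un:
  assumes "connected_on E (V - C)" "connected_on E (V - D)"
    and no_edge: "\<And>x y. x \<in> C \<Longrightarrow> y \<in> D \<Longrightarrow> (x, y) \<notin> E" and "C \<inter> D = {}"
  shows "connected_on E (V - (C \<union> D))"
proof (rule ccontr)
  define W where "W = V - (C \<union> D)"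
  assume "\<not> ?thesis"
  then obtain a b where ab: "a \<in> W" "b \<in> W" "(a, b) \<notin> (E \<inter> W \<times> W)\<^sup>*"
    unfolding connected_on_def W_def by blast
  define A where "A = {z. (a, z) \<in> (E \<inter> W \<times> W)\<^sup>*}"
  have A: "x \<in> A \<longleftrightarrow> y \<in> A" if "(x, y) \<in> E" "x \<in> W" "y \<in> W" for x y
    using that E_sym[OF that(1)] unfolding A_def by (auto intro: rtrancl_into_rtrancl)
  define c :: "'v \<Rightarrow> 'v \<Rightarrow> real"
    where "c x y = (if x \<in> C \<or> y \<in> C then indicator A y - indicator A x else 0)" for x y
  obtain h where h: "\<And>x y. (x, y) \<in> E \<Longrightarrow> c x y = h y - (h x :: real)"
  proof (rule cocycleE[of c])
    fix u v w assume e: "(u, v) \<in> E" "(v, w) \<in> E" "(u, w) \<in> E"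
    have V: "u \<in> V" "v \<in> V" "w \<in> V"
      using e E_V E_V' by auto
    show "c u w = c u v + c v w"
    proof (cases "u \<in> C \<or> v \<in> C \<or> w \<in> C")
      case True
      then have "u \<notin> D" "v \<notin> D" "w \<notin> D"
        using no_edge e E_sym \<open>C \<inter> D = {}\<close> by blast+
      \<comment> \<open>This includes a side avoiding \<open>C\<close>: it lies in \<open>W\<close>,
        where the indicator does not jump.\<close>
      then have "c x y = indicator A y - indicator A x"
        if "(x, y) \<in> E" "x \<in> {u, v, w}" "y \<in> {u, v, w}" for x y
        using that V A[OF that(1)] by (auto simp: c_def W_def indicator_def)
      then show ?thesis
        using e by simp
    qed (simp add: c_def)
  qed (auto simp: c_def)
  have "h a = h b"
    using assms(1)
  proof (rule connected_on_invariant)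
    fix x y assume "(x, y) \<in> E" "x \<in> V - C" "y \<in> V - C"
    then show "h x = h y"
      using h[of x y] by (simp add: c_def)
  qed (use ab in \<open>auto simp: W_def\<close>)
  moreover have "h a - indicator A a = h b - indicator A b"
    using assms(2)
  proof (rule connected_on_invariant)
    fix x y assume "(x, y) \<in> E" "x \<in> V - D" "y \<in> V - D"
    then show "h x - indicator A x = h y - indicator A y"
      using h[of x y] A[of x y] by (auto simp: c_def W_def indicator_def split: if_splits)
  qed (use ab in \<open>auto simp: W_def\<close>)
  moreover have "a \<in> A" "b \<notin> A"
    using ab by (auto simp: A_def)
  ultimately show False
    by simp
qed

text \<open>If \<open>D\<close> is not connected, one of its components and the rest of
  \<open>D\<close> have no edges between them, so one of the two still separates. The descent ends
  at a connected set, nonempty because the whole graph is connected.\<close>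

lemma separating_connected_subset:
  assumes "D \<subseteq> V" "\<not> connected_on E (V - D)"
  obtains C where "C \<subseteq> D" "C \<noteq> {}" "connected_on E C" "\<not> connected_on E (V - C)"
proof -
  have "finite D"
    using assms(1) finite_V by (rule finite_subset)
  then have "\<exists>C\<subseteq>D. C \<noteq> {} \<and> connected_on E C \<and> \<not> connected_on E (V - C)"
    using assms
  proof (induction D rule: finite_psubset_induct)
    case (psubset D)
    show ?case
    proof (cases "connected_on E D")
      case True
      moreover have "D \<noteq> {}"
        using psubset.prems E_connected by auto
      ultimately show ?thesis
        using psubset.prems by blast
    next
      case False
      then obtain x y where xy: "x \<in> D" "y \<in> D" "(x, y) \<notin> (E \<inter> D \<times> D)\<^sup>*"
        unfolding connected_on_def by blast
      define C where "C = {z \<in> D. (x, z) \<in> (E \<inter> D \<times> D)\<^sup>*}"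
      have no_edge: "(p, q) \<notin> E" if "p \<in> C" "q \<in> D - C" for p q
        using that by (auto simp: C_def intro: rtrancl_into_rtrancl)
      have "x \<in> C" "y \<in> D - C"
        using xy by (auto simp: C_def)
      then have sub: "C \<subset> D" "D - C \<subset> D"
        by (auto simp: C_def)
      have "C \<union> (D - C) = D"
        using sub by blast
      then have "\<not> connected_on E (V - C) \<or> \<not> connected_on E (V - (D - C))"
        using connected_on_minus_Un[of C "D - C"] no_edge psubset.prems(2) by auto
      then obtain D' where D': "D' \<subset> D" "\<not> connected_on E (V - D')"
        using sub by blast
      then have "\<exists>C\<subseteq>D'. C \<noteq> {} \<and> connected_on E C \<and> \<not> connected_on E (V - C)"
        using psubset.prems(1) by (intro psubset.IH) auto
      then show ?thesis
        using D'(1) by blast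
    qed
  qed
  then show ?thesis
    using that by blast
qed

end

text \<open>The combinatorial content of the absence of separating dead subgraphs and cut vertices:
  no component of a level set separates, single vertices included, and no vertex has dead edges
  only.\<close>

locale nonseparating_levels = acyclic_graph V E for V :: "'v set" and E +
  fixes f :: "'v \<Rightarrow> real"
  assumes level_component_connected: "x \<in> V \<Longrightarrow>
      connected_on E (V - {y. (x, y) \<in> {(p, q). (p, q) \<in> E \<and> f p = f q}\<^sup>*})"
    and live_neighbour: "x \<in> V \<Longrightarrow> \<exists>y. (x, y) \<in> E \<and> f x \<noteq> f y"
begin

definition dead :: "('v \<times> 'v) set" where
  "dead = {(p, q). (p, q) \<in> E \<and> f p = f q}"

definition live :: "('v \<times> 'v) set" where
  "live = {(p, q). (p, q) \<in> E \<and> f p \<noteq> f q}"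

text \<open>Live edges in a common simplex. Every live edge is related to itself and to its reverse,
  so the classes generated do not depend on orientations.\<close>

definition commuting :: "(('v \<times> 'v) \<times> ('v \<times> 'v)) set" where
  "commuting = {((u, v), (u', v')). (u, v) \<in> live \<and> (u', v') \<in> live \<and>
     (\<forall>p\<in>{u, v}. \<forall>q\<in>{u', v'}. p = q \<or> (p, q) \<in> E)}"

text \<open>The side from \<open>y\<close> to \<open>z\<close> is live too, since
  \<open>f x = f y\<close>: the dead edge lies in a triangle with two live sides, with whose
  elements its own element commutes.\<close>

definition dominated :: "('v \<times> 'v) set" where
  "dominated = {(x, y) \<in> dead. \<exists>z. (x, z) \<in> live \<and> (y, z) \<in> E}"

definition level_component :: "'v \<Rightarrow> 'v set" where
  "level_component x = {y. (x, y) \<in> dead\<^sup>*}"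

lemma live_sym: "(x, y) \<in> live \<Longrightarrow> (y, x) \<in> live"
  using E_sym by (auto simp: live_def)

lemma commuting_sym: "(e, e') \<in> commuting \<Longrightarrow> (e', e) \<in> commuting"
  unfolding commuting_def using E_sym by auto

lemma commuting_reverse: "(x, y) \<in> live \<Longrightarrow> ((x, y), (y, x)) \<in> commuting"
  using E_sym live_sym by (auto simp: commuting_def live_def)

lemma commuting_triangle:
  assumes "(x, y) \<in> live" "(y, z) \<in> live" "(x, z) \<in> E"
  shows "((x, y), (y, z)) \<in> commuting"
  using assms by (auto simp: commuting_def live_def)

lemma level_component_step:
  assumes "p \<in> level_component x" "(p, q) \<in> E"
  shows "q \<in> level_component x \<longleftrightarrow> f q = f p"
proof
  have f: "f x = f y" if "y \<in> level_component x" for y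
    using that unfolding level_component_def
    by (auto elim!: rtrancl_invariant simp: dead_def)
  show "f q = f p" if "q \<in> level_component x"
    using f[OF that] f[OF assms(1)] by simp
  show "q \<in> level_component x" if "f q = f p"
    using assms that by (auto simp: level_component_def dead_def intro: rtrancl_into_rtrancl)
qed

lemma complement_level_component: "x \<in> V \<Longrightarrow> connected_on E (V - level_component x)"
  using level_component_connected by (simp add: level_component_def dead_def)

text \<open>
  Otherwise orient the edges from the component to its complement: the indicator of a single
  class of these edges is a cocycle, and it is not a coboundary because both sides are connected.
\<close>

lemma commuting_at_component:
  assumes x0: "x0 \<in> V" and "(x, y) \<in> live" "x \<in> level_component x0"
    and "(x', y') \<in> live" "x' \<in> level_component x0"
  shows "((x, y), (x', y')) \<in> commuting\<^sup>*"
proof (rule ccontr)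
  assume neg: "\<not> ?thesis"
  define D where "D = level_component x0"
  define K where "K = {e. ((x, y), e) \<in> commuting\<^sup>*}"
  have K_step: "e \<in> K \<longleftrightarrow> e' \<in> K" if "(e, e') \<in> commuting" for e e'
    using that commuting_sym[OF that] by (auto simp: K_def intro: rtrancl_into_rtrancl)
  have D_step: "f p = f q" if "p \<in> D" "q \<in> D" "(p, q) \<in> E" for p q
    using level_component_step[of p x0 q] that by (simp add: D_def)
  have D_out: "(p, q) \<in> live" if "p \<in> D" "q \<notin> D" "(p, q) \<in> E" for p q
    using level_component_step[of p x0 q] that by (simp add: D_def live_def)
  define c :: "'v \<Rightarrow> 'v \<Rightarrow> real"
    where "c p q = of_bool (p \<in> D \<and> q \<notin> D \<and> (p, q) \<in> K) - of_bool (q \<in> D \<and> p \<notin> D \<and> (q, p) \<in> K)" for p q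
  have apex: "(p, r) \<in> K \<longleftrightarrow> (q, r) \<in> K" if "(p, r) \<in> live" "(q, r) \<in> live" "(p, q) \<in> E" for p q r
    using K_step[OF commuting_triangle[OF that(1) live_sym[OF that(2)] that(3)]]
      K_step[OF commuting_reverse[OF that(2)]] by simp
  \<comment> \<open>The side from \<open>q\<close> to \<open>r\<close> may be dead or live; only the
    two sides at \<open>p\<close> have to be live.\<close>
  have base: "(p, q) \<in> K \<longleftrightarrow> (p, r) \<in> K" if "(p, q) \<in> live" "(p, r) \<in> live" "(q, r) \<in> E" for p q r
    using apex[OF live_sym[OF that(1)] live_sym[OF that(2)] that(3)]
      K_step[OF commuting_reverse[OF that(1)]] K_step[OF commuting_reverse[OF that(2)]] by simp
  have c_anti: "c q p = - c p q" for p q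
    by (simp add: c_def)
  have c_same: "c p q = 0" if "p \<in> D \<longleftrightarrow> q \<in> D" for p q
    using that by (simp add: c_def)
  have c_apex: "c p r = c q r"
    if "p \<in> D" "q \<in> D" "r \<notin> D" "(p, r) \<in> E" "(q, r) \<in> E" "(p, q) \<in> E" for p q r
    using apex[OF D_out[OF that(1,3,4)] D_out[OF that(2,3,5)] that(6)] that(1-3) by (simp add: c_def)
  have c_base: "c p q = c p r"
    if "p \<in> D" "q \<notin> D" "r \<notin> D" "(p, q) \<in> E" "(p, r) \<in> E" "(q, r) \<in> E" for p q r
    using base[OF D_out[OF that(1,2,4)] D_out[OF that(1,3,5)] that(6)] that(1-3) by (simp add: c_def)
  obtain h where h: "\<And>p q. (p, q) \<in> E \<Longrightarrow> c p q = h q - (h p :: real)"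
  proof (rule cocycleE[of c])
    fix u v w assume e: "(u, v) \<in> E" "(v, w) \<in> E" "(u, w) \<in> E"
    note e' = e e[THEN E_sym]
    \<comment> \<open>A triangle has either no side or exactly two sides crossing the boundary of
      \<open>D\<close>. Two crossing sides share a vertex outside \<open>D\<close>
      (\<open>c_apex\<close>) or inside \<open>D\<close> (\<open>c_base\<close>) and carry the same
      value up to orientation.\<close>
    consider "u \<in> D \<longleftrightarrow> v \<in> D" "v \<in> D \<longleftrightarrow> w \<in> D"
      | "u \<in> D" "v \<in> D" "w \<notin> D" | "u \<in> D" "v \<notin> D" "w \<in> D" | "u \<notin> D" "v \<in> D" "w \<in> D"
      | "u \<in> D" "v \<notin> D" "w \<notin> D" | "u \<notin> D" "v \<in> D" "w \<notin> D" | "u \<notin> D" "v \<notin> D" "w \<in> D"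
      by blast
    then show "c u w = c u v + c v w"
    proof cases
      case 1
      then show ?thesis by (simp add: c_same)
    next
      case 2
      then show ?thesis using c_apex[of u v w] c_same[of u v] e' by simp
    next
      case 3
      then show ?thesis using c_apex[of u w v] c_same[of u w] c_anti[of w v] e' by simp
    next
      case 4
      then show ?thesis
        using c_apex[of v w u] c_same[of v w] c_anti[of v u] c_anti[of w u] e' by simp
    next
      case 5
      then show ?thesis using c_base[of u v w] c_same[of v w] e' by simp
    next
      case 6
      then show ?thesis using c_base[of v u w] c_same[of u w] c_anti[of v u] e' by simp
    next
      case 7
      then show ?thesis
        using c_base[of w u v] c_same[of u v] c_anti[of w u] c_anti[of w v] e' by simp
    qed
  qed (rule c_anti, blast)
  have hD: "h p = h q" if "p \<in> D" "q \<in> D" for p q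
  proof -
    have "h x0 = h r" if "r \<in> D" for r
    proof -
      have "(x0, r) \<in> dead\<^sup>*"
        using that by (simp add: D_def level_component_def)
      then have "h x0 = h r \<and> r \<in> D"
      proof (induction rule: rtrancl_induct)
        case base
        then show ?case by (simp add: D_def level_component_def)
      next
        case (step y z)
        then have "z \<in> D" "(y, z) \<in> E"
          by (auto simp: D_def level_component_def dead_def intro: rtrancl_into_rtrancl)
        then show ?case
          using step h[of y z] by (simp add: c_def)
      qed
      then show ?thesis ..
    qed
    then show ?thesis
      using that by metis
  qed
  have hC: "h p = h q" if "p \<in> V - D" "q \<in> V - D" for p q
    using complement_level_component[OF x0, folded D_def] that
  proof (rule connected_on_invariant)
    fix r s assume "(r, s) \<in> E" "r \<in> V - D" "s \<in> V - D"
    then show "h r = h s"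
      using h[of r s] by (simp add: c_def)
  qed
  have E: "(x, y) \<in> E" "(x', y') \<in> E" "f x \<noteq> f y" "f x' \<noteq> f y'"
    using assms by (auto simp: live_def)
  have D: "x \<in> D" "y \<notin> D" "x' \<in> D" "y' \<notin> D"
    using assms E level_component_step[of x x0 y] level_component_step[of x' x0 y']
    by (auto simp: D_def)
  have "(x, y) \<in> K" "(x', y') \<notin> K"
    using neg by (auto simp: K_def)
  then have "c x y = 1" "c x' y' = 0"
    using D by (simp_all add: c_def)
  then show False
    using h[OF E(1)] h[OF E(2)] hD[OF D(1,3)] hC[of y y'] D E E_V' by simp
qed

text \<open>Follow a path from \<open>x\<close> to \<open>x'\<close>. Live edges starting in one
  level component are all equivalent, so nothing changes across a dead edge, where
  \<open>live_neighbour\<close> supplies a live edge for comparison; a live edge is crossed by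
  reversing it.\<close>

lemma commuting_live_connected:
  assumes "(x, y) \<in> live" "(x', y') \<in> live"
  shows "((x, y), (x', y')) \<in> commuting\<^sup>*"
proof -
  have V: "x \<in> V" "x' \<in> V"
    using assms E_V by (auto simp: live_def)
  have "(x, x') \<in> (E \<inter> V \<times> V)\<^sup>*"
    using E_connected V by (simp add: connected_on_def)
  then have "\<forall>z. (x', z) \<in> live \<longrightarrow> ((x, y), (x', z)) \<in> commuting\<^sup>*"
  proof (induction rule: rtrancl_induct)
    case base
    then show ?case
      using commuting_at_component[OF V(1) assms(1)] by (simp add: level_component_def)
  next
    case (step p q)
    then have pq: "(p, q) \<in> E" "p \<in> V" "q \<in> V"
      by auto
    obtain w where w: "(p, w) \<in> live"
      using live_neighbour[OF pq(2)] by (auto simp: live_def)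
    show ?case
    proof (cases "f p = f q")
      case True
      then have "q \<in> level_component p"
        using pq by (auto simp: level_component_def dead_def)
      moreover have "p \<in> level_component p"
        by (simp add: level_component_def)
      ultimately show ?thesis
        using step.IH w commuting_at_component[OF pq(2)] by (meson rtrancl_trans)
    next
      case False
      then have pq': "(p, q) \<in> live"
        using pq by (simp add: live_def)
      have "q \<in> level_component q"
        by (simp add: level_component_def)
      then have "((q, p), (q, z)) \<in> commuting\<^sup>*" if "(q, z) \<in> live" for z
        using commuting_at_component[OF pq(3) live_sym[OF pq']] that by blast
      then show ?thesis
        using step.IH pq' commuting_reverse[OF pq'] by (meson rtrancl.rtrancl_into_rtrancl rtrancl_trans)
    qed
  qed
  then show ?thesis
    using assms(2) by blast
qed

text \<open>
  If the vertices reachable from \<open>u\<close> by dominated edges did not fill the level component, the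
  coboundary of their indicator, restricted to the component, would be a cocycle that is not a
  coboundary.
\<close>

lemma dead_imp_dominated:
  assumes uv: "(u, v) \<in> dead"
  shows "(u, v) \<in> dominated\<^sup>*"
proof -
  define D where "D = level_component u"
  define U where "U = {x. (u, x) \<in> dominated\<^sup>*}"
  have dom_sym: "(y, x) \<in> dominated" if "(x, y) \<in> dominated" for x y
    using that E_sym by (auto simp: dominated_def dead_def live_def)
  have U_step: "x \<in> U \<longleftrightarrow> y \<in> U" if "(x, y) \<in> dominated" for x y
    using that dom_sym[OF that] by (auto simp: U_def intro: rtrancl_into_rtrancl)
  have D_step: "f p = f q" if "p \<in> D" "q \<in> D" "(p, q) \<in> E" for p q
    using level_component_step[of p u q] that by (simp add: D_def)
  have D_out: "(p, q) \<in> live" if "p \<in> D" "q \<notin> D" "(p, q) \<in> E" for p q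
    using level_component_step[of p u q] that by (simp add: D_def live_def)
  define c :: "'v \<Rightarrow> 'v \<Rightarrow> real"
    where "c x y = (if x \<in> D \<and> y \<in> D then indicator U y - indicator U x else 0)" for x y
  \<comment> \<open>A vertex outside \<open>D\<close> adjacent to both ends of an edge of
    \<open>D\<close> makes this edge dominated, so the indicator of \<open>U\<close> does not jump
    along it.\<close>
  have c0: "c x y = 0" if "(x, y) \<in> E" "(y, z) \<in> E" "(x, z) \<in> E" "z \<notin> D" for x y z
  proof (cases "x \<in> D \<and> y \<in> D")
    case True
    then have "(x, y) \<in> dominated"
      using that D_step[of x y] D_out[of x z] by (auto simp: dominated_def dead_def)
    then show ?thesis
      using U_step by (auto simp: c_def indicator_def)
  qed (auto simp: c_def)
  obtain h where h: "\<And>p q. (p, q) \<in> E \<Longrightarrow> c p q = h q - (h p :: real)"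
  proof (rule cocycleE[of c])
    fix x y z assume e: "(x, y) \<in> E" "(y, z) \<in> E" "(x, z) \<in> E"
    note e' = e e[THEN E_sym]
    show "c x z = c x y + c y z"
    proof (cases "x \<in> D \<and> y \<in> D \<and> z \<in> D")
      case False
      then have "c x y = 0" "c y z = 0" "c x z = 0"
        using c0[of x y z] c0[of x z y] c0[of y z x] e' by (auto simp: c_def)
      then show ?thesis by simp
    qed (simp add: c_def)
  qed (auto simp: c_def)
  have V: "u \<in> V" "v \<in> V" and E: "(u, v) \<in> E"
    using uv E_V E_V' by (auto simp: dead_def)
  have D: "u \<in> D" "v \<in> D"
    using uv by (auto simp: D_def level_component_def)
  \<comment> \<open>The cochain vanishes on edges leaving \<open>D\<close>, so each value of
    \<open>h\<close> on \<open>D\<close> also occurs outside. There \<open>h\<close> is constant,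
    which forces \<open>h u = h v\<close>.\<close>
  have out: "\<exists>z\<in>V - D. h z = h x" if "x \<in> V" "x \<in> D" for x
  proof -
    obtain z where z: "(x, z) \<in> E" "f x \<noteq> f z"
      using live_neighbour[OF \<open>x \<in> V\<close>] by blast
    then have "z \<notin> D"
      using D_step that by blast
    moreover have "z \<in> V"
      using z E_V' by blast
    moreover have "h z = h x"
      using h[OF z(1)] \<open>z \<notin> D\<close> by (simp add: c_def)
    ultimately show ?thesis
      by blast
  qed
  obtain z z' where z: "z \<in> V - D" "z' \<in> V - D" "h z = h u" "h z' = h v"
    using out V D by metis
  have "h z = h z'"
    using complement_level_component[OF V(1), folded D_def] z(1,2)
  proof (rule connected_on_invariant)
    fix r s assume "(r, s) \<in> E" "r \<in> V - D" "s \<in> V - D"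
    then show "h r = h s"
      using h[of r s] by (simp add: c_def)
  qed
  then have "indicator U v = (indicator U u :: real)"
    using h[OF E] D z by (simp add: c_def)
  then show ?thesis
    by (auto simp: U_def indicator_def split: if_splits)
qed

end

subsection \<open>Right-angled Artin groups and their Bestvina-Brady subgroups\<close>

definition letter_sum :: "('x \<Rightarrow> real) \<Rightarrow> 'x word \<Rightarrow> real" where
  "letter_sum f w = (\<Sum>(x, b)\<leftarrow>w. if b then f x else - f x)"

lemma letter_sum_simps [simp]:
  "letter_sum f [] = 0"
  "letter_sum f ((x, b) # w) = (if b then f x else - f x) + letter_sum f w"
  "letter_sum f (v @ w) = letter_sum f v + letter_sum f w"
  by (simp_all add: letter_sum_def)

lemma letter_sum_pres_rel:
  assumes "(v, w) \<in> pres_rel X R" "\<And>r. r \<in> R \<Longrightarrow> letter_sum f r = 0"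
  shows "letter_sum f v = letter_sum f w"
  using assms(1)
  by (induction rule: pres_rel.induct) (simp_all add: assms(2))

text \<open>On words of exponent sum zero only differences of \<open>f\<close> count, so a potential
  may be normalised to vanish on a chosen level.\<close>

lemma letter_sum_diff_const:
  "letter_sum (\<lambda>x. f x - a) w = letter_sum f w - a * exponent_sum w"
  by (induction w) (auto simp: algebra_simps)

definition word_class :: "'v pair_pre_digraph \<Rightarrow> 'v word \<Rightarrow> 'v word set" where
  "word_class \<Gamma> w = pres_rel (pverts \<Gamma>) (raag_relators \<Gamma>) `` {w}"

lemma word_class_eq_iff:
  assumes "v \<in> words (pverts \<Gamma>)" "w \<in> words (pverts \<Gamma>)"
  shows "word_class \<Gamma> v = word_class \<Gamma> w \<longleftrightarrow> (v, w) \<in> pres_rel (pverts \<Gamma>) (raag_relators \<Gamma>)"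
  unfolding word_class_def using assms by (rule pres_class_eq_iff)

lemma word_class_mult:
  assumes "v \<in> words (pverts \<Gamma>)" "w \<in> words (pverts \<Gamma>)"
  shows "word_class \<Gamma> v \<otimes>\<^bsub>raag \<Gamma>\<^esub> word_class \<Gamma> w = word_class \<Gamma> (v @ w)"
  unfolding word_class_def raag_def using assms by (rule pres_mult)

lemma word_class_Nil: "word_class \<Gamma> [] = \<one>\<^bsub>raag \<Gamma>\<^esub>"
  by (simp add: word_class_def raag_def pres_one)

lemma word_class_closed: "w \<in> words (pverts \<Gamma>) \<Longrightarrow> word_class \<Gamma> w \<in> carrier (raag \<Gamma>)"
  by (simp add: word_class_def raag_def pres_class_closed)

lemma word_class_cases:
  assumes "A \<in> carrier (raag \<Gamma>)"
  obtains w where "w \<in> words (pverts \<Gamma>)" "A = word_class \<Gamma> w"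
  using assms unfolding raag_def word_class_def by (rule pres_carrierE)

lemma word_class_eq_cancel:
  assumes "x \<in> pverts \<Gamma>"
  shows "word_class \<Gamma> [(x, b), (x, \<not> b)] = \<one>\<^bsub>raag \<Gamma>\<^esub>"
proof -
  have "([] @ [(x, b), (x, \<not> b)] @ [], [] @ []) \<in> pres_rel (pverts \<Gamma>) (raag_relators \<Gamma>)"
    using assms by (intro pres_rel.cancel) auto
  then show ?thesis
    using assms by (simp add: word_class_Nil[symmetric] word_class_eq_iff)
qed

lemma raag_gen_eq_word_class: "raag_gen \<Gamma> x = word_class \<Gamma> [(x, True)]"
  by (simp add: raag_gen_def pres_gen_def word_class_def)

lemma inv_raag_gen:
  assumes "x \<in> pverts \<Gamma>"
  shows "inv\<^bsub>raag \<Gamma>\<^esub> raag_gen \<Gamma> x = word_class \<Gamma> [(x, False)]"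
proof -
  interpret A: Group.group "raag \<Gamma>"
    by (rule group_raag)
  have "word_class \<Gamma> [(x, False)] \<otimes>\<^bsub>raag \<Gamma>\<^esub> raag_gen \<Gamma> x = \<one>\<^bsub>raag \<Gamma>\<^esub>"
    using assms word_class_eq_cancel[OF assms, of False]
    by (simp add: raag_gen_eq_word_class word_class_mult)
  then show ?thesis
    using assms by (intro A.inv_equality) (auto intro: raag_gen_closed word_class_closed)
qed

lemma edge_element_eq_word_class:
  assumes "u \<in> pverts \<Gamma>" "v \<in> pverts \<Gamma>"
  shows "edge_element \<Gamma> (u, v) = word_class \<Gamma> [(v, True), (u, False)]"
  using assms by (simp add: edge_element_def inv_raag_gen) (simp add: raag_gen_eq_word_class word_class_mult)

lemma bb_group_simps [simp]:
  "mult (bb_group \<Gamma>) = mult (raag \<Gamma>)" "one (bb_group \<Gamma>) = one (raag \<Gamma>)"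
  by (simp_all add: bb_group_def)

lemma word_class_in_bb_group:
  assumes "w \<in> words (pverts \<Gamma>)"
  shows "word_class \<Gamma> w \<in> carrier (bb_group \<Gamma>) \<longleftrightarrow> exponent_sum w = 0"
  using assms word_class_closed[OF assms] raag_height_class[OF assms]
  by (simp add: bb_group_def kernel_def word_class_def)

lemma bb_group_subgroup: "subgroup (carrier (bb_group \<Gamma>)) (raag \<Gamma>)"
  by (simp add: bb_group_def group_hom.subgroup_kernel[OF raag_height_group_hom])

lemma bb_group_carrier: "carrier (bb_group \<Gamma>) \<subseteq> carrier (raag \<Gamma>)"
  using bb_group_subgroup by (rule subgroup.subset)

lemma bb_group_cases:
  assumes "g \<in> carrier (bb_group \<Gamma>)"
  obtains w where "w \<in> words (pverts \<Gamma>)" "exponent_sum w = 0" "g = word_class \<Gamma> w"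
proof -
  have "g \<in> carrier (raag \<Gamma>)"
    using assms bb_group_carrier by auto
  then obtain w where "w \<in> words (pverts \<Gamma>)" "g = word_class \<Gamma> w"
    by (rule word_class_cases)
  then show ?thesis
    using assms that word_class_in_bb_group by blast
qed

lemma inv_bb_group:
  "g \<in> carrier (bb_group \<Gamma>) \<Longrightarrow> inv\<^bsub>bb_group \<Gamma>\<^esub> g = inv\<^bsub>raag \<Gamma>\<^esub> g"
  using group.m_inv_consistent[OF group_raag bb_group_subgroup] by (simp add: bb_group_def)

lemma (in Group.group) inv_cancel_left:
  assumes "x \<in> carrier G" "y \<in> carrier G"
  shows "inv x \<otimes> (x \<otimes> y) = y" "x \<otimes> (inv x \<otimes> y) = y"
  using assms by (simp_all add: m_assoc[symmetric])

lemma edge_element_mult: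
  assumes "u \<in> pverts \<Gamma>" "v \<in> pverts \<Gamma>" "w \<in> pverts \<Gamma>"
  shows "edge_element \<Gamma> (v, w) \<otimes>\<^bsub>raag \<Gamma>\<^esub> edge_element \<Gamma> (u, v) = edge_element \<Gamma> (u, w)"
proof -
  interpret A: Group.group "raag \<Gamma>"
    by (rule group_raag)
  show ?thesis
    using assms by (simp add: edge_element_def raag_gen_closed A.m_assoc A.inv_cancel_left)
qed

lemma edge_element_self: "u \<in> pverts \<Gamma> \<Longrightarrow> edge_element \<Gamma> (u, u) = \<one>\<^bsub>raag \<Gamma>\<^esub>"
  by (simp add: edge_element_def raag_gen_closed group.r_inv[OF group_raag])

section \<open>Generation of the Bestvina-Brady group by edges\<close>

locale connected_pair_graph = pair_graph \<Gamma> for \<Gamma> :: "'v pair_pre_digraph" +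
  assumes rtrancl_arcs: "u \<in> pverts \<Gamma> \<Longrightarrow> v \<in> pverts \<Gamma> \<Longrightarrow> (u, v) \<in> (parcs \<Gamma>)\<^sup>*"
begin

sublocale A: Group.group "raag \<Gamma>"
  by (rule group_raag)

sublocale B: Group.group "bb_group \<Gamma>"
  by (rule group_bb_group)

lemma arcs_sym: "(u, v) \<in> parcs \<Gamma> \<Longrightarrow> (v, u) \<in> parcs \<Gamma>"
  using pair_sym_arcs by (auto simp: symmetric_def sym_def)

abbreviation gen where "gen \<equiv> raag_gen \<Gamma>"

lemma gen_commute:
  assumes "(u, v) \<in> parcs \<Gamma>"
  shows "gen u \<otimes>\<^bsub>raag \<Gamma>\<^esub> gen v = gen v \<otimes>\<^bsub>raag \<Gamma>\<^esub> gen u"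
proof -
  have V: "u \<in> pverts \<Gamma>" "v \<in> pverts \<Gamma>"
    using assms in_arcsD1 in_arcsD2 by auto
  have "([] @ [(u, True), (v, True), (u, False), (v, False)] @ [], [] @ []) \<in>
      pres_rel (pverts \<Gamma>) (raag_relators \<Gamma>)"
    using assms V by (intro pres_rel.relator) (auto simp: raag_relators_def)
  then have "\<one>\<^bsub>raag \<Gamma>\<^esub> = word_class \<Gamma> ([(u, True), (v, True)] @ [(u, False), (v, False)])"
    using V by (simp add: word_class_Nil[symmetric] word_class_eq_iff pres_rel.sym)
  also have "\<dots> = word_class \<Gamma> [(u, True), (v, True)] \<otimes>\<^bsub>raag \<Gamma>\<^esub> word_class \<Gamma> [(u, False), (v, False)]"
    using V by (intro word_class_mult[symmetric]) auto
  also have "word_class \<Gamma> [(u, True), (v, True)] = gen u \<otimes>\<^bsub>raag \<Gamma>\<^esub> gen v"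
    using V by (simp add: raag_gen_eq_word_class word_class_mult)
  also have "word_class \<Gamma> [(u, False), (v, False)] = inv\<^bsub>raag \<Gamma>\<^esub> gen u \<otimes>\<^bsub>raag \<Gamma>\<^esub> inv\<^bsub>raag \<Gamma>\<^esub> gen v"
    using V by (simp add: inv_raag_gen word_class_mult)
  also have "gen u \<otimes>\<^bsub>raag \<Gamma>\<^esub> gen v \<otimes>\<^bsub>raag \<Gamma>\<^esub>
      (inv\<^bsub>raag \<Gamma>\<^esub> gen u \<otimes>\<^bsub>raag \<Gamma>\<^esub> inv\<^bsub>raag \<Gamma>\<^esub> gen v) =
      (gen u \<otimes>\<^bsub>raag \<Gamma>\<^esub> gen v) \<otimes>\<^bsub>raag \<Gamma>\<^esub> inv\<^bsub>raag \<Gamma>\<^esub> (gen v \<otimes>\<^bsub>raag \<Gamma>\<^esub> gen u)"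
    using V by (simp add: raag_gen_closed A.inv_mult_group)
  finally show ?thesis
    using V by (metis A.inv_solve_right A.l_one A.m_closed A.one_closed raag_gen_closed)
qed

lemma gen_commute_inv:
  assumes "(u, v) \<in> parcs \<Gamma> \<or> u = v" "u \<in> pverts \<Gamma>"
  shows "gen v \<otimes>\<^bsub>raag \<Gamma>\<^esub> inv\<^bsub>raag \<Gamma>\<^esub> gen u = inv\<^bsub>raag \<Gamma>\<^esub> gen u \<otimes>\<^bsub>raag \<Gamma>\<^esub> gen v"
proof -
  have V: "gen u \<in> carrier (raag \<Gamma>)" "gen v \<in> carrier (raag \<Gamma>)"
    using assms in_arcsD2 by (auto intro: raag_gen_closed)
  have "gen u \<otimes>\<^bsub>raag \<Gamma>\<^esub> gen v = gen v \<otimes>\<^bsub>raag \<Gamma>\<^esub> gen u"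
    using assms gen_commute by auto
  then show ?thesis
    using V by (metis A.inv_closed A.inv_solve_left A.m_assoc A.m_closed A.r_inv A.r_one)
qed

lemma edge_element_commute:
  assumes "\<And>p q. p \<in> {u, v} \<Longrightarrow> q \<in> {u', v'} \<Longrightarrow> p = q \<or> (p, q) \<in> parcs \<Gamma>"
    and "{u, v, u', v'} \<subseteq> pverts \<Gamma>"
  shows "edge_element \<Gamma> (u, v) \<otimes>\<^bsub>raag \<Gamma>\<^esub> edge_element \<Gamma> (u', v') =
    edge_element \<Gamma> (u', v') \<otimes>\<^bsub>raag \<Gamma>\<^esub> edge_element \<Gamma> (u, v)"
proof -
  have V: "gen u \<in> carrier (raag \<Gamma>)" "gen v \<in> carrier (raag \<Gamma>)"
      "gen u' \<in> carrier (raag \<Gamma>)" "gen v' \<in> carrier (raag \<Gamma>)"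
    using assms by (auto intro: raag_gen_closed)
  have gc: "gen p \<otimes>\<^bsub>raag \<Gamma>\<^esub> gen q = gen q \<otimes>\<^bsub>raag \<Gamma>\<^esub> gen p" if "p \<in> {u, v}" "q \<in> {u', v'}" for p q
    using assms(1)[OF that] gen_commute by auto
  have comm_inv: "x \<otimes>\<^bsub>raag \<Gamma>\<^esub> inv\<^bsub>raag \<Gamma>\<^esub> y = inv\<^bsub>raag \<Gamma>\<^esub> y \<otimes>\<^bsub>raag \<Gamma>\<^esub> x"
    if "x \<otimes>\<^bsub>raag \<Gamma>\<^esub> y = y \<otimes>\<^bsub>raag \<Gamma>\<^esub> x" "x \<in> carrier (raag \<Gamma>)" "y \<in> carrier (raag \<Gamma>)" for x y
    using that by (metis A.inv_closed A.inv_solve_left A.m_assoc A.m_closed A.r_inv A.r_one)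
  have comm_mult: "x \<otimes>\<^bsub>raag \<Gamma>\<^esub> (y \<otimes>\<^bsub>raag \<Gamma>\<^esub> z) = y \<otimes>\<^bsub>raag \<Gamma>\<^esub> z \<otimes>\<^bsub>raag \<Gamma>\<^esub> x"
    if "x \<otimes>\<^bsub>raag \<Gamma>\<^esub> y = y \<otimes>\<^bsub>raag \<Gamma>\<^esub> x" "x \<otimes>\<^bsub>raag \<Gamma>\<^esub> z = z \<otimes>\<^bsub>raag \<Gamma>\<^esub> x"
      "x \<in> carrier (raag \<Gamma>)" "y \<in> carrier (raag \<Gamma>)" "z \<in> carrier (raag \<Gamma>)" for x y z
    using that by (metis A.m_assoc)
  have 1: "gen p \<otimes>\<^bsub>raag \<Gamma>\<^esub> edge_element \<Gamma> (u', v') = edge_element \<Gamma> (u', v') \<otimes>\<^bsub>raag \<Gamma>\<^esub> gen p"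
    if "p \<in> {u, v}" for p
    unfolding edge_element_def using that V
    by (simp del: A.inv_mult_group) (intro comm_mult comm_inv gc; auto)
  have e: "edge_element \<Gamma> (u', v') \<in> carrier (raag \<Gamma>)"
    using V by (simp add: edge_element_def)
  have "edge_element \<Gamma> (u', v') \<otimes>\<^bsub>raag \<Gamma>\<^esub> edge_element \<Gamma> (u, v) =
      edge_element \<Gamma> (u, v) \<otimes>\<^bsub>raag \<Gamma>\<^esub> edge_element \<Gamma> (u', v')"
    unfolding edge_element_def[of _ "(u, v)"] fst_conv snd_conv
    using 1[symmetric] V e by (intro comm_mult comm_inv; auto)
  then show ?thesis ..
qed

abbreviation edges where "edges \<equiv> edge_element \<Gamma> ` parcs \<Gamma>"

lemma edges_closed: "edges \<subseteq> carrier (bb_group \<Gamma>)"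
  using edge_element_closed in_arcsD1 in_arcsD2 by fastforce

lemma subgroup_generate_edges: "subgroup (generate (raag \<Gamma>) edges) (raag \<Gamma>)"
  using edges_closed bb_group_carrier by (intro A.generate_is_subgroup) blast

text \<open>Telescoping along a path from \<open>u\<close> to \<open>v\<close>. Along a single edge
  the generators commute, so the quotient of their \<open>k\<close>-th powers is the
  \<open>k\<close>-th power of the edge element.\<close>

lemma gen_pow_div_in_generate:
  assumes "u \<in> pverts \<Gamma>" "v \<in> pverts \<Gamma>"
  shows "gen v [^]\<^bsub>raag \<Gamma>\<^esub> (k::int) \<otimes>\<^bsub>raag \<Gamma>\<^esub> inv\<^bsub>raag \<Gamma>\<^esub> (gen u [^]\<^bsub>raag \<Gamma>\<^esub> k)
    \<in> generate (raag \<Gamma>) edges"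
  using rtrancl_arcs[OF assms]
proof (induction rule: rtrancl_induct)
  case base
  then show ?case
    using assms by (simp add: raag_gen_closed generate.one)
next
  case (step v w)
  have V: "gen u \<in> carrier (raag \<Gamma>)" "gen v \<in> carrier (raag \<Gamma>)" "gen w \<in> carrier (raag \<Gamma>)"
    using assms step.hyps in_arcsD1 in_arcsD2 by (auto intro: raag_gen_closed)
  have "edge_element \<Gamma> (v, w) [^]\<^bsub>raag \<Gamma>\<^esub> k \<in> generate (raag \<Gamma>) edges"
    using step.hyps(2) subgroup_generate_edges
    by (intro A.subgroup_int_pow_closed) (auto intro: generate.incl)
  also have "edge_element \<Gamma> (v, w) [^]\<^bsub>raag \<Gamma>\<^esub> k =
      gen w [^]\<^bsub>raag \<Gamma>\<^esub> k \<otimes>\<^bsub>raag \<Gamma>\<^esub> inv\<^bsub>raag \<Gamma>\<^esub> (gen v [^]\<^bsub>raag \<Gamma>\<^esub> k)"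
    unfolding edge_element_def fst_conv snd_conv
    using V gen_commute_inv[of v w] step.hyps in_arcsD1
    by (subst A.int_pow_mult_distrib) (auto simp: A.int_pow_inv)
  finally have "(gen w [^]\<^bsub>raag \<Gamma>\<^esub> k \<otimes>\<^bsub>raag \<Gamma>\<^esub> inv\<^bsub>raag \<Gamma>\<^esub> (gen v [^]\<^bsub>raag \<Gamma>\<^esub> k)) \<otimes>\<^bsub>raag \<Gamma>\<^esub>
      (gen v [^]\<^bsub>raag \<Gamma>\<^esub> k \<otimes>\<^bsub>raag \<Gamma>\<^esub> inv\<^bsub>raag \<Gamma>\<^esub> (gen u [^]\<^bsub>raag \<Gamma>\<^esub> k)) \<in> generate (raag \<Gamma>) edges"
    using step.IH by (rule generate.eng)
  then show ?case
    using V by (simp add: A.m_assoc A.inv_cancel_left)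
qed

text \<open>Letters are appended on the right. With \<open>k\<close> the exponent sum of
  \<open>w\<close>, the element \<open>w x^e v0^-(k+e)\<close> is the product of
  \<open>w v0^-k\<close>, \<open>v0^k x^-k\<close> and \<open>x^(k+e) v0^-(k+e)\<close>. Quotients
  of powers take the place of conjugates of edges.\<close>

lemma word_class_div_in_generate:
  assumes "v0 \<in> pverts \<Gamma>" "w \<in> words (pverts \<Gamma>)"
  shows "word_class \<Gamma> w \<otimes>\<^bsub>raag \<Gamma>\<^esub> inv\<^bsub>raag \<Gamma>\<^esub> (gen v0 [^]\<^bsub>raag \<Gamma>\<^esub> exponent_sum w)
    \<in> generate (raag \<Gamma>) edges"
  using assms(2)
proof (induction w rule: rev_induct)
  case Nil
  then show ?case
    using assms by (simp add: word_class_Nil generate.one)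
next
  case (snoc a w)
  obtain x b where a: "a = (x, b)"
    by (cases a)
  have w: "w \<in> words (pverts \<Gamma>)" and x: "x \<in> pverts \<Gamma>"
    using snoc.prems a by auto
  define k where "k = exponent_sum w"
  define e :: int where "e = (if b then 1 else - 1)"
  have [simp]: "gen v0 \<in> carrier (raag \<Gamma>)" "gen x \<in> carrier (raag \<Gamma>)"
      "word_class \<Gamma> w \<in> carrier (raag \<Gamma>)"
    using assms x w by (auto intro: raag_gen_closed word_class_closed)
  have letter: "word_class \<Gamma> [(x, b)] = gen x [^]\<^bsub>raag \<Gamma>\<^esub> e"
    using x by (cases b) (simp_all add: e_def A.int_pow_neg inv_raag_gen raag_gen_eq_word_class[symmetric])
  have pow_add: "gen x [^]\<^bsub>raag \<Gamma>\<^esub> (k + e) = gen x [^]\<^bsub>raag \<Gamma>\<^esub> k \<otimes>\<^bsub>raag \<Gamma>\<^esub> gen x [^]\<^bsub>raag \<Gamma>\<^esub> e"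
    by (simp add: A.int_pow_mult)
  let ?H = "generate (raag \<Gamma>) edges"
  have 1: "word_class \<Gamma> w \<otimes>\<^bsub>raag \<Gamma>\<^esub> inv\<^bsub>raag \<Gamma>\<^esub> (gen v0 [^]\<^bsub>raag \<Gamma>\<^esub> k) \<in> ?H"
    using snoc.IH[OF w] by (simp add: k_def)
  have 2: "gen v0 [^]\<^bsub>raag \<Gamma>\<^esub> k \<otimes>\<^bsub>raag \<Gamma>\<^esub> inv\<^bsub>raag \<Gamma>\<^esub> (gen x [^]\<^bsub>raag \<Gamma>\<^esub> k) \<in> ?H"
    by (rule gen_pow_div_in_generate[OF x assms(1)])
  have 3: "gen x [^]\<^bsub>raag \<Gamma>\<^esub> (k + e) \<otimes>\<^bsub>raag \<Gamma>\<^esub> inv\<^bsub>raag \<Gamma>\<^esub> (gen v0 [^]\<^bsub>raag \<Gamma>\<^esub> (k + e)) \<in> ?H"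
    by (rule gen_pow_div_in_generate[OF assms(1) x])
  have "word_class \<Gamma> (w @ [a]) \<otimes>\<^bsub>raag \<Gamma>\<^esub> inv\<^bsub>raag \<Gamma>\<^esub> (gen v0 [^]\<^bsub>raag \<Gamma>\<^esub> (k + e)) =
      (word_class \<Gamma> w \<otimes>\<^bsub>raag \<Gamma>\<^esub> inv\<^bsub>raag \<Gamma>\<^esub> (gen v0 [^]\<^bsub>raag \<Gamma>\<^esub> k)) \<otimes>\<^bsub>raag \<Gamma>\<^esub>
      ((gen v0 [^]\<^bsub>raag \<Gamma>\<^esub> k \<otimes>\<^bsub>raag \<Gamma>\<^esub> inv\<^bsub>raag \<Gamma>\<^esub> (gen x [^]\<^bsub>raag \<Gamma>\<^esub> k)) \<otimes>\<^bsub>raag \<Gamma>\<^esub>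
       (gen x [^]\<^bsub>raag \<Gamma>\<^esub> (k + e) \<otimes>\<^bsub>raag \<Gamma>\<^esub> inv\<^bsub>raag \<Gamma>\<^esub> (gen v0 [^]\<^bsub>raag \<Gamma>\<^esub> (k + e))))"
    using w x
    by (simp add: a word_class_mult[symmetric] letter pow_add A.m_assoc
        A.inv_cancel_left)
  also have "\<dots> \<in> ?H"
    using 1 2 3 by (blast intro: generate.eng)
  finally show ?case
    using a by (simp add: k_def e_def)
qed

lemma finite_generating_edges: "finite_generating_set (bb_group \<Gamma>) edges"
proof -
  have gen_eq: "generate (bb_group \<Gamma>) edges = generate (raag \<Gamma>) edges"
    unfolding bb_group_def
    using A.generate_consistent[OF _ bb_group_subgroup] edges_closed by (simp add: bb_group_def)
  have "g \<in> generate (raag \<Gamma>) edges" if g: "g \<in> carrier (bb_group \<Gamma>)" for g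
  proof -
    obtain w where w: "w \<in> words (pverts \<Gamma>)" "exponent_sum w = 0" "g = word_class \<Gamma> w"
      using g by (rule bb_group_cases)
    show ?thesis
    \<comment> \<open>The empty word also occurs over the empty graph, which has no base
      vertex.\<close>
    proof (cases "w = []")
      case True
      then show ?thesis
        using w by (simp add: word_class_Nil generate.one)
    next
      case False
      then obtain v0 where "v0 \<in> pverts \<Gamma>"
        using w(1) by (cases w) auto
      then show ?thesis
        using word_class_div_in_generate[OF _ w(1), of v0] w
        by (simp add: word_class_closed)
    qed
  qed
  moreover have "generate (bb_group \<Gamma>) edges \<subseteq> carrier (bb_group \<Gamma>)"
    using edges_closed by (rule B.generate_incl)
  ultimately show ?thesis
    using edges_closed pair_finite_arcs gen_eq by (auto simp: finite_generating_set_def)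
qed

end

section \<open>Characters as potentials on the vertices\<close>

locale bb_character = connected_pair_graph \<Gamma> for \<Gamma> :: "'v pair_pre_digraph" +
  fixes \<phi> :: "'v word set \<Rightarrow> real"
  assumes character: "\<phi> \<in> nonzero_characters (bb_group \<Gamma>)"
begin

lemma \<phi>_mult:
  "g \<in> carrier (bb_group \<Gamma>) \<Longrightarrow> h \<in> carrier (bb_group \<Gamma>) \<Longrightarrow> \<phi> (g \<otimes>\<^bsub>raag \<Gamma>\<^esub> h) = \<phi> g + \<phi> h"
  using character by (auto simp: nonzero_characters_def hom_def real_group_def)

lemma \<phi>_one: "\<phi> \<one>\<^bsub>raag \<Gamma>\<^esub> = 0"
  using \<phi>_mult[of "\<one>\<^bsub>raag \<Gamma>\<^esub>" "\<one>\<^bsub>raag \<Gamma>\<^esub>"] B.one_closed by simp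

text \<open>The pair need not be an edge: \<open>edge_element\<close> of any two vertices lies in
  the Bestvina-Brady group, so no path from the base vertex has to be chosen.\<close>

definition potential :: "'v \<Rightarrow> real" where
  "potential v = \<phi> (edge_element \<Gamma> (SOME u. u \<in> pverts \<Gamma>, v))"

lemma \<phi>_edge_element:
  assumes "u \<in> pverts \<Gamma>" "v \<in> pverts \<Gamma>"
  shows "\<phi> (edge_element \<Gamma> (u, v)) = potential v - potential u"
proof -
  define o' where "o' = (SOME u. u \<in> pverts \<Gamma>)"
  have o': "o' \<in> pverts \<Gamma>"
    unfolding o'_def using assms(1) by (rule someI)
  have "\<phi> (edge_element \<Gamma> (u, v)) + \<phi> (edge_element \<Gamma> (o', u)) = \<phi> (edge_element \<Gamma> (o', v))"
    using assms o' edge_element_mult[of o' \<Gamma> u v] \<phi>_mult by (metis edge_element_closed)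
  then show ?thesis
    by (simp add: potential_def o'_def)
qed

text \<open>The letter sum of the potential is well defined on the whole Artin group and agrees with
  \<phi> on the edges, hence on everything they generate. In particular \<phi> extends to the Artin
  group.\<close>

lemma \<phi>_word_class:
  assumes w: "w \<in> words (pverts \<Gamma>)" "exponent_sum w = 0"
  shows "\<phi> (word_class \<Gamma> w) = letter_sum potential w"
proof -
  have inv: "letter_sum potential v = letter_sum potential w"
    if "word_class \<Gamma> v = word_class \<Gamma> w" "v \<in> words (pverts \<Gamma>)" "w \<in> words (pverts \<Gamma>)" for v w
    using that
    by (intro letter_sum_pres_rel[of v w "pverts \<Gamma>" "raag_relators \<Gamma>"])
      (auto simp: word_class_eq_iff raag_relators_def)
  have "\<exists>v\<in>words (pverts \<Gamma>). word_class \<Gamma> v = g \<and> \<phi> g = letter_sum potential v"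
    if "g \<in> generate (bb_group \<Gamma>) edges" for g
    using that
  proof (induction rule: generate.induct)
    case one
    then show ?case
      by (intro bexI[of _ "[]"]) (auto simp: word_class_Nil \<phi>_one)
  next
    case (incl g)
    then obtain u v where e: "(u, v) \<in> parcs \<Gamma>" "g = edge_element \<Gamma> (u, v)"
      by auto
    then have "u \<in> pverts \<Gamma>" "v \<in> pverts \<Gamma>"
      using in_arcsD1 in_arcsD2 by auto
    then show ?case
      using e by (intro bexI[of _ "[(v, True), (u, False)]"])
        (auto simp: edge_element_eq_word_class[symmetric] \<phi>_edge_element)
  next
    case (inv g)
    then obtain u v where e: "(u, v) \<in> parcs \<Gamma>" "g = edge_element \<Gamma> (u, v)"
      by auto
    then have V: "u \<in> pverts \<Gamma>" "v \<in> pverts \<Gamma>"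
      using in_arcsD1 in_arcsD2 by auto
    have "inv\<^bsub>bb_group \<Gamma>\<^esub> g = edge_element \<Gamma> (v, u)"
      unfolding e(2) inv_bb_group[OF edge_element_closed[OF V]] edge_element_swap[OF V] ..
    then show ?case
      using V by (intro bexI[of _ "[(u, True), (v, False)]"])
        (auto simp: edge_element_eq_word_class[symmetric] \<phi>_edge_element)
  next
    case (eng g h)
    then obtain a b where ab: "a \<in> words (pverts \<Gamma>)" "word_class \<Gamma> a = g" "\<phi> g = letter_sum potential a"
        "b \<in> words (pverts \<Gamma>)" "word_class \<Gamma> b = h" "\<phi> h = letter_sum potential b"
      by blast
    have "g \<in> carrier (bb_group \<Gamma>)" "h \<in> carrier (bb_group \<Gamma>)"
      using eng B.generate_incl[OF edges_closed] by auto
    then show ?case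
      using ab by (intro bexI[of _ "a @ b"]) (auto simp: word_class_mult[symmetric] \<phi>_mult)
  qed
  moreover have "word_class \<Gamma> w \<in> generate (bb_group \<Gamma>) edges"
    using finite_generating_edges word_class_in_bb_group[OF w(1)] w(2)
    by (simp add: finite_generating_set_def)
  ultimately show ?thesis
    using inv w(1) by metis
qed

lemma potential_nonconstant: "\<exists>v\<in>pverts \<Gamma>. potential v \<noteq> a"
proof (rule ccontr)
  assume *: "\<not> ?thesis"
  have "\<phi> g = 0" if g: "g \<in> carrier (bb_group \<Gamma>)" for g
  proof -
    obtain w where w: "w \<in> words (pverts \<Gamma>)" "exponent_sum w = 0" "g = word_class \<Gamma> w"
      using g by (rule bb_group_cases)
    have "letter_sum potential w = a * exponent_sum w"
      using w(1) * by (induction w) (auto simp: algebra_simps)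
    then show ?thesis
      using \<phi>_word_class w by simp
  qed
  then show False
    using character by (auto simp: nonzero_characters_def)
qed

end

subsection \<open>Separating levels\<close>

text \<open>
  A stack, read from its last entry to its first, is an element in normal form of the free product
  of two copies of an abelian group; the entries are tagged by the free factor they belong to.
\<close>

fun reduced_stack :: "(bool \<times> 'm::zero) list \<Rightarrow> bool" where
  "reduced_stack [] \<longleftrightarrow> True"
| "reduced_stack [(t, m)] \<longleftrightarrow> m \<noteq> 0"
| "reduced_stack ((t, m) # (t', m') # s) \<longleftrightarrow> m \<noteq> 0 \<and> t \<noteq> t' \<and> reduced_stack ((t', m') # s)"

text \<open>Right multiplication by \<open>m\<close> from the factor \<open>t\<close>: the head is
  the rightmost syllable, and it is merged, cancelled or covered. Zero acts trivially whatever its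
  tag.\<close>

definition push :: "bool \<Rightarrow> 'm \<Rightarrow> (bool \<times> 'm) list \<Rightarrow> (bool \<times> 'm::ab_group_add) list" where
  "push t m s =
     (if m = 0 then s
      else case s of [] \<Rightarrow> [(t, m)]
        | (t', m') # r \<Rightarrow> if t' \<noteq> t then (t, m) # s else if m' + m = 0 then r else (t, m' + m) # r)"

definition stack_sum :: "(bool \<times> 'm::monoid_add) list \<Rightarrow> 'm" where
  "stack_sum s = sum_list (map snd s)"

lemma stack_sum_simps [simp]:
  "stack_sum [] = 0" "stack_sum ((t, m) # s) = m + stack_sum s"
  by (simp_all add: stack_sum_def)

lemma push_0 [simp]: "push t 0 s = s"
  by (simp add: push_def)

lemma reduced_stack_Cons: "reduced_stack ((t, m) # s) \<longleftrightarrow> m \<noteq> 0 \<and> reduced_stack s \<and> (s \<noteq> [] \<longrightarrow> fst (hd s) \<noteq> t)"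
  by (cases s) auto

lemma reduced_push: "reduced_stack s \<Longrightarrow> reduced_stack (push t m s)"
  by (cases s) (auto simp: push_def reduced_stack_Cons)

lemma push_new: "m \<noteq> 0 \<Longrightarrow> (s \<noteq> [] \<Longrightarrow> fst (hd s) \<noteq> t) \<Longrightarrow> push t m s = (t, m) # s"
  by (cases s) (auto simp: push_def)

lemma push_top: "m \<noteq> 0 \<Longrightarrow> push t m ((t, x) # s) = (if x + m = 0 then s else (t, x + m) # s)"
  by (simp add: push_def)

text \<open>Each factor acts on normal forms. Reducedness matters when the top entry cancels: the
  entry below then carries the other tag and cannot merge.\<close>

lemma push_push:
  assumes "reduced_stack s"
  shows "push t m (push t m' s) = push t (m' + m) s"
proof (cases "m = 0 \<or> m' = 0")
  case False
  show ?thesis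
  proof (cases "s \<noteq> [] \<and> fst (hd s) = t")
    case True
    then obtain x r where s: "s = (t, x) # r"
      by (cases s) auto
    have r: "x \<noteq> 0" "r \<noteq> [] \<Longrightarrow> fst (hd r) \<noteq> t"
      using assms by (auto simp: s reduced_stack_Cons)
    show ?thesis
    proof (cases "x + m' = 0")
      case True
      have eq: "x + (m' + m) = m"
        using True by (simp add: add.assoc[symmetric])
      have "push t (m' + m) s = (t, m) # r"
      proof (cases "m' + m = 0")
        case True
        then show ?thesis
          using eq by (simp add: s)
      next
        case nz: False
        show ?thesis
          unfolding s push_top[OF nz] eq using False by simp
      qed
      moreover have "push t m r = (t, m) # r"
        using False r by (intro push_new) auto
      ultimately show ?thesis
        using True False by (simp add: s push_top)
    next
      case F: False
      then show ?thesis
        using False r(1) by (cases "m' + m = 0") (auto simp: s push_top add.assoc)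
    qed
  next
    case F: False
    then have "push t n s = (t, n) # s" if "n \<noteq> 0" for n
      using that by (intro push_new) auto
    then show ?thesis
      using False by (cases "m' + m = 0") (auto simp: push_top)
  qed
qed auto

lemma stack_sum_push: "stack_sum (push t m s) = m + stack_sum s"
proof (cases s)
  case (Cons a r)
  then show ?thesis
    by (cases a) (auto simp: push_def algebra_simps add_eq_0_iff)
qed (auto simp: push_def)

lemma last_push: "s \<noteq> [] \<Longrightarrow> push t m s \<noteq> [] \<Longrightarrow> fst (last (push t m s)) = fst (last s)"
  by (cases s) (auto simp: push_def split: if_splits)

definition run :: "('x \<Rightarrow> bool) \<Rightarrow> ('x \<Rightarrow> 'm) \<Rightarrow> 'x word \<Rightarrow> (bool \<times> 'm) list \<Rightarrow> (bool \<times> 'm::ab_group_add) list" where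
  "run T \<mu> w s = fold (\<lambda>(x, b). push (T x) (if b then \<mu> x else - \<mu> x)) w s"

lemma run_simps [simp]:
  "run T \<mu> [] s = s"
  "run T \<mu> ((x, b) # w) s = run T \<mu> w (push (T x) (if b then \<mu> x else - \<mu> x) s)"
  "run T \<mu> (v @ w) s = run T \<mu> w (run T \<mu> v s)"
  by (simp_all add: run_def)

lemma reduced_run: "reduced_stack s \<Longrightarrow> reduced_stack (run T \<mu> w s)"
  by (induction w arbitrary: s) (auto simp: reduced_push)

text \<open>The ends of an edge lie in one factor or one of them is killed, so an edge acts by a
  single push. Thus a stack cannot be emptied and refilled within one edge, and its bottom tag can
  only change by passing through an empty stack.\<close>

lemma push_pair:
  assumes "T u = T v \<or> \<mu> u = 0 \<or> \<mu> v = 0" "reduced_stack s"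
  shows "\<exists>t. push (T u) (- \<mu> u) (push (T v) (\<mu> v) s) = push t (\<mu> v - \<mu> u) s"
  using assms by (auto simp: push_push)

lemma run_relator:
  assumes "T u = T v \<or> \<mu> u = 0 \<or> \<mu> v = 0" "reduced_stack s"
  shows "run T \<mu> [(u, True), (v, True), (u, False), (v, False)] s = s"
  using assms by (auto simp: push_push reduced_push)

lemma run_pres_rel:
  assumes "(v, w) \<in> pres_rel (pverts \<Gamma>) (raag_relators \<Gamma>)" "reduced_stack s"
    and "\<And>u v. (u, v) \<in> parcs \<Gamma> \<Longrightarrow> T u = T v \<or> \<mu> u = 0 \<or> \<mu> v = 0"
  shows "run T \<mu> v s = run T \<mu> w s"
  using assms(1)
proof (induction rule: pres_rel.induct)
  case (cancel u v x b)
  then show ?case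
    using reduced_run[OF assms(2), of T \<mu> u] by (simp add: push_push)
next
  case (relator u v r)
  then obtain x y where "r = [(x, True), (y, True), (x, False), (y, False)]" "(x, y) \<in> parcs \<Gamma>"
    by (auto simp: raag_relators_def)
  then have "run T \<mu> r (run T \<mu> u s) = run T \<mu> u s"
    using run_relator[of T x y \<mu>, OF assms(3)] reduced_run[OF assms(2), of T \<mu> u] by blast
  then show ?case
    by (simp only: run_simps(3))
qed simp_all

lemma fst_stack_sum_run:
  fixes \<mu> :: "'x \<Rightarrow> real \<times> 'm::ab_group_add"
  shows "fst (stack_sum (run T \<mu> w s)) = letter_sum (\<lambda>x. fst (\<mu> x)) w + fst (stack_sum s)"
  by (induction w arbitrary: s) (auto simp: stack_sum_push)

lemma letter_sum_cong:
  "w \<in> words X \<Longrightarrow> (\<And>x. x \<in> X \<Longrightarrow> f x = g x) \<Longrightarrow> letter_sum f w = letter_sum g w"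
  by (induction w) auto

text \<open>
  Killing the separator maps \<open>BB\<close> onto a free product through which the character factors.  In the
  Bass-Serre tree, crossing the edge of the coset of an element of negative value requires passing
  through that coset.  The stack records the position relative to this edge, and its last entry
  records the side.
\<close>

lemma (in bb_character) separating_level_not_nonneg_connected:
  assumes V: "pverts \<Gamma> = A \<union> B \<union> C" "A \<inter> B = {}" "A \<inter> C = {}" "B \<inter> C = {}"
    and no_edge: "\<And>x y. x \<in> A \<Longrightarrow> y \<in> B \<Longrightarrow> (x, y) \<notin> parcs \<Gamma>"
    and a: "a \<in> A" "potential a \<noteq> p0" and b: "b \<in> B" and c: "c \<in> C"
    and level: "\<And>x. x \<in> C \<Longrightarrow> potential x = p0"
  shows "\<not> nonneg_connected (bb_group \<Gamma>) edges \<phi>"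
proof
  assume con: "nonneg_connected (bb_group \<Gamma>) edges \<phi>"
  define T where "T x \<longleftrightarrow> x \<in> A" for x
  \<comment> \<open>The first component records \<phi>. The constant second component keeps
    generators outside \<open>C\<close> nontrivial even on the level \<open>p0\<close>, where
    \<open>b\<close> may lie.\<close>
  define \<mu> :: "'v \<Rightarrow> real \<times> real" where "\<mu> x = (if x \<in> C then 0 else (potential x - p0, 1))" for x
  have arc: "T u = T v \<or> \<mu> u = 0 \<or> \<mu> v = 0" if "(u, v) \<in> parcs \<Gamma>" for u v
    using V no_edge[of u v] no_edge[of v u] that arcs_sym[OF that] in_arcsD1[OF that] in_arcsD2[OF that]
    by (auto simp: T_def \<mu>_def)
  define \<epsilon> where "\<epsilon> \<longleftrightarrow> potential a > p0"
  define \<eta> where "\<eta> \<longleftrightarrow> potential b > p0"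
  define m where "m = (if \<epsilon> then \<mu> a else - \<mu> a)"
  have m: "fst m > 0" "m \<noteq> 0"
    using a V by (auto simp: m_def \<epsilon>_def \<mu>_def zero_prod_def)
  \<comment> \<open>Starting at a positive \<open>m\<close> keeps the total of the stack positive
    wherever \<phi> is non-negative, so the stack is never empty there.\<close>
  define s0 where "s0 = [(True, m)]"
  have s0: "reduced_stack s0"
    using m by (simp add: s0_def)
  define \<psi> where "\<psi> g = run T \<mu> (SOME w. w \<in> words (pverts \<Gamma>) \<and> word_class \<Gamma> w = g) s0" for g
  have \<psi>: "\<psi> (word_class \<Gamma> w) = run T \<mu> w s0" if "w \<in> words (pverts \<Gamma>)" for w
  proof -
    define v where "v = (SOME v. v \<in> words (pverts \<Gamma>) \<and> word_class \<Gamma> v = word_class \<Gamma> w)"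
    have "v \<in> words (pverts \<Gamma>) \<and> word_class \<Gamma> v = word_class \<Gamma> w"
      unfolding v_def by (rule someI[of _ w]) (use that in simp)
    then have "(v, w) \<in> pres_rel (pverts \<Gamma>) (raag_relators \<Gamma>)"
      using that word_class_eq_iff by blast
    then show ?thesis
      using run_pres_rel[OF _ s0 arc] by (simp add: \<psi>_def v_def)
  qed
  have sum: "fst (stack_sum (\<psi> g)) = \<phi> g + fst m" if g: "g \<in> carrier (bb_group \<Gamma>)" for g
  proof -
    obtain w where w: "w \<in> words (pverts \<Gamma>)" "exponent_sum w = 0" "g = word_class \<Gamma> w"
      using g by (rule bb_group_cases)
    have "letter_sum (\<lambda>x. fst (\<mu> x)) w = letter_sum (\<lambda>x. potential x - p0) w"
      using w(1) by (rule letter_sum_cong) (auto simp: \<mu>_def level)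
    then show ?thesis
      using w by (simp add: \<psi> fst_stack_sum_run \<phi>_word_class letter_sum_diff_const s0_def)
  qed
  let ?P = "{g \<in> carrier (bb_group \<Gamma>). 0 \<le> \<phi> g}"
  have nonempty: "\<psi> g \<noteq> []" if "g \<in> ?P" for g
    using sum[of g] that m(1) by auto
  have edge: "fst (last (\<psi> h)) = fst (last (\<psi> g))"
    if P: "g \<in> ?P" "h \<in> ?P" and hg: "h = g \<otimes>\<^bsub>raag \<Gamma>\<^esub> edge_element \<Gamma> (u, v)" and arc_uv: "(u, v) \<in> parcs \<Gamma>" for g h u v
  proof -
    have "g \<in> carrier (bb_group \<Gamma>)"
      using P(1) by simp
    then obtain w where w: "w \<in> words (pverts \<Gamma>)" "exponent_sum w = 0" "g = word_class \<Gamma> w"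
      by (rule bb_group_cases)
    have uv: "u \<in> pverts \<Gamma>" "v \<in> pverts \<Gamma>"
      using arc_uv in_arcsD1 in_arcsD2 by auto
    have "h = word_class \<Gamma> (w @ [(v, True), (u, False)])"
      using w uv hg by (simp add: edge_element_eq_word_class word_class_mult)
    then have "\<psi> h = push (T u) (- \<mu> u) (push (T v) (\<mu> v) (\<psi> g))"
      using w uv by (simp add: \<psi>)
    moreover have "reduced_stack (\<psi> g)"
      using w s0 by (simp add: \<psi> reduced_run)
    ultimately obtain t where "\<psi> h = push t (\<mu> v - \<mu> u) (\<psi> g)"
      using push_pair[OF arc[OF arc_uv]] by metis
    then show ?thesis
      using last_push[OF nonempty[OF P(1)]] nonempty[OF P(2)] by simp
  qed
  \<comment> \<open>A conjugate of \<open>b\<close> times an inverse of \<open>c\<close>, up to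
    signs. The first occurrence of \<open>a\<close> cancels the entry \<open>m\<close>,
    \<open>b\<close> starts a stack in the other factor, and the second occurrence of
    \<open>a\<close> covers it. The signs make the value of the whole word
    \<open>\<bar>potential b - p0\<bar>\<close>, although the prefix that empties the stack has
    negative value. The letters \<open>c\<close> act trivially and balance the exponent sum.\<close>
  define w where "w = [(c, \<epsilon>), (a, \<not> \<epsilon>), (b, \<eta>), (c, \<not> \<eta>), (a, \<epsilon>), (c, \<not> \<epsilon>)]"
  have w: "w \<in> words (pverts \<Gamma>)" "exponent_sum w = 0"
    using a b c V by (auto simp: w_def)
  have "letter_sum potential w \<ge> 0"
    using level[OF c] by (auto simp: w_def \<eta>_def)
  then have w_P: "word_class \<Gamma> w \<in> ?P"
    using w by (simp add: \<phi>_word_class word_class_in_bb_group)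
  have one_P: "\<one>\<^bsub>raag \<Gamma>\<^esub> \<in> ?P"
    using \<phi>_one B.one_closed by simp
  have "(\<one>\<^bsub>raag \<Gamma>\<^esub>, word_class \<Gamma> w) \<in> (parcs (cayley_graph (bb_group \<Gamma>) edges) \<inter> ?P \<times> ?P)\<^sup>*"
    using con w_P one_P unfolding nonneg_connected_def cayley_reachable_iff by blast
  then have "fst (last (\<psi> \<one>\<^bsub>raag \<Gamma>\<^esub>)) = fst (last (\<psi> (word_class \<Gamma> w)))"
  proof (rule rtrancl_invariant)
    fix g h assume gh: "(g, h) \<in> parcs (cayley_graph (bb_group \<Gamma>) edges) \<inter> ?P \<times> ?P"
    then obtain u v where uv: "(u, v) \<in> parcs \<Gamma>"
        "h = g \<otimes>\<^bsub>raag \<Gamma>\<^esub> edge_element \<Gamma> (u, v) \<or> g = h \<otimes>\<^bsub>raag \<Gamma>\<^esub> edge_element \<Gamma> (u, v)"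
      by (auto simp: cayley_graph_def)
    have P: "g \<in> ?P" "h \<in> ?P"
      using gh by auto
    from uv(2) show "fst (last (\<psi> g)) = fst (last (\<psi> h))"
    proof
      assume "h = g \<otimes>\<^bsub>raag \<Gamma>\<^esub> edge_element \<Gamma> (u, v)"
      then show ?thesis
        using edge[OF P _ uv(1)] by simp
    next
      assume "g = h \<otimes>\<^bsub>raag \<Gamma>\<^esub> edge_element \<Gamma> (u, v)"
      then show ?thesis
        using edge[OF P(2,1) _ uv(1)] by simp
    qed
  qed
  moreover have "\<psi> \<one>\<^bsub>raag \<Gamma>\<^esub> = [(True, m)]"
    using \<psi>[of "[]"] by (simp add: word_class_Nil s0_def)
  moreover have "\<psi> (word_class \<Gamma> w) = [(True, m), (False, if \<eta> then \<mu> b else - \<mu> b)]"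
  proof -
    have "\<mu> c = 0" "T a" "\<not> T b" "\<mu> b \<noteq> 0"
      using a b c V by (auto simp: T_def \<mu>_def zero_prod_def)
    moreover have "(if \<not> \<epsilon> then \<mu> a else - \<mu> a) = - m"
      by (auto simp: m_def)
    ultimately show ?thesis
      using m(2) unfolding \<psi>[OF w(1)] unfolding w_def s0_def
      by (auto simp: push_def m_def)
  qed
  ultimately show False
    by simp
qed

subsection \<open>Raising paths\<close>

text \<open>
  Right multiplication by powers of \<open>t\<close> raises the level of a path: an edge from \<open>g\<close> to \<open>g s\<close> is
  replaced by the translate by \<open>g\<close> of a path from \<open>t\<close> to \<open>s t\<close>.
\<close>

lemma nonneg_connectedI:
  fixes G (structure) and \<phi> :: "'g \<Rightarrow> real"
  assumes "group G"
    and hom: "\<And>g h. g \<in> carrier G \<Longrightarrow> h \<in> carrier G \<Longrightarrow> \<phi> (g \<otimes> h) = \<phi> g + \<phi> h"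
    and S: "finite_generating_set G S" and S_inv: "\<And>s. s \<in> S \<Longrightarrow> inv s \<in> S"
    and t: "t \<in> S" "\<phi> t > 0"
    and path: "\<And>s. s \<in> S \<Longrightarrow> 0 \<le> \<phi> s \<Longrightarrow> (t, s \<otimes> t) \<in>
      (parcs (cayley_graph G S) \<inter> {g \<in> carrier G. 0 < \<phi> g} \<times> {g \<in> carrier G. 0 < \<phi> g})\<^sup>*"
  shows "nonneg_connected G S \<phi>"
proof -
  interpret group G by fact
  define R where "R c = parcs (cayley_graph G S) \<inter> {g \<in> carrier G. c \<le> \<phi> g} \<times> {g \<in> carrier G. c \<le> \<phi> g}"
    for c :: real
  have Sc: "finite S" "S \<subseteq> carrier G" "generate G S = carrier G"
    using S by (auto simp: finite_generating_set_def)
  have tc [simp]: "t \<in> carrier G"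
    using t Sc by auto
  have one: "\<phi> \<one> = 0"
    using hom[of \<one> \<one>] by simp
  have inv: "\<phi> (inv g) = - \<phi> g" if "g \<in> carrier G" for g
    using hom[of g "inv g"] that one by simp
  have R_step: "(g, g \<otimes> s) \<in> R c" if "g \<in> carrier G" "s \<in> S" "c \<le> \<phi> g" "c \<le> \<phi> (g \<otimes> s)" for g s c
    using that Sc by (auto simp: R_def cayley_graph_def)
  have symR: "(h, g) \<in> (R c)\<^sup>*" if "(g, h) \<in> (R c)\<^sup>*" for g h c
  proof -
    have "sym (R c)"
      by (auto simp: R_def cayley_graph_def sym_def)
    then show ?thesis
      using that by (meson sym_rtrancl symD)
  qed
  have mono: "(g, h) \<in> (R d)\<^sup>*" if "(g, h) \<in> (R c)\<^sup>*" "d \<le> c" for g h c d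
  proof -
    have "R c \<subseteq> R d"
      using that(2) by (auto simp: R_def)
    then show ?thesis
      using that(1) rtrancl_mono by blast
  qed
  have left: "(a \<otimes> g, a \<otimes> h) \<in> (R (c + \<phi> a))\<^sup>*" if "(g, h) \<in> (R c)\<^sup>*" "a \<in> carrier G" for a g h c
    using that(1)
  proof (induction rule: rtrancl_induct)
    case (step y z)
    have yz: "y \<in> carrier G" "z \<in> carrier G" "c \<le> \<phi> y" "c \<le> \<phi> z"
      using step(2) by (auto simp: R_def)
    from step(2) obtain s where s: "s \<in> S" "z = y \<otimes> s \<or> y = z \<otimes> s"
      by (auto simp: R_def cayley_graph_def)
    then have "a \<otimes> z = a \<otimes> y \<otimes> s \<or> a \<otimes> y = a \<otimes> z \<otimes> s"
      using yz that(2) Sc(2) by (auto simp: m_assoc)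
    then have "(a \<otimes> y, a \<otimes> z) \<in> R (c + \<phi> a)"
      using yz that(2) s(1) by (auto simp: R_def cayley_graph_def hom)
    with step(3) show ?case
      by (rule rtrancl_into_rtrancl)
  qed simp
  \<comment> \<open>A path has finitely many vertices and, in \<open>bound\<close>, there are
    finitely many generators; so positivity becomes a uniform gain \<epsilon>.\<close>
  have positive: "\<exists>\<epsilon>>0. (t, h) \<in> (R \<epsilon>)\<^sup>*"
    if "(t, h) \<in> (parcs (cayley_graph G S) \<inter> {g \<in> carrier G. 0 < \<phi> g} \<times> {g \<in> carrier G. 0 < \<phi> g})\<^sup>*" for h
    using that
  proof (induction rule: rtrancl_induct)
    case base
    then show ?case by (intro exI[of _ 1]) simp
  next
    case (step y z)
    then obtain \<epsilon> where "\<epsilon> > 0" "(t, y) \<in> (R \<epsilon>)\<^sup>*"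
      by blast
    moreover define \<delta> where "\<delta> = min \<epsilon> (min (\<phi> y) (\<phi> z))"
    moreover have "(y, z) \<in> R \<delta>"
      using step(2) by (auto simp: R_def \<delta>_def)
    ultimately show ?case
      using step(2) mono[of t y \<epsilon> \<delta>]
      by (intro exI[of _ \<delta>]) (auto intro: rtrancl_into_rtrancl)
  qed
  have bound: "\<exists>\<epsilon>>0. \<forall>s\<in>F. 0 \<le> \<phi> s \<longrightarrow> (t, s \<otimes> t) \<in> (R \<epsilon>)\<^sup>*" if "finite F" "F \<subseteq> S" for F
    using that
  proof (induction F rule: finite_induct)
    case empty
    show ?case by (intro exI[of _ 1]) simp
  next
    case (insert s F)
    then obtain \<epsilon> where \<epsilon>: "\<epsilon> > 0" "\<forall>s\<in>F. 0 \<le> \<phi> s \<longrightarrow> (t, s \<otimes> t) \<in> (R \<epsilon>)\<^sup>*"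
      by auto
    obtain \<delta> where \<delta>: "\<delta> > 0" "0 \<le> \<phi> s \<Longrightarrow> (t, s \<otimes> t) \<in> (R \<delta>)\<^sup>*"
    proof (cases "0 \<le> \<phi> s")
      case True
      then show ?thesis
        using positive[OF path[OF _ True]] insert.prems that by auto
    qed (use that[of 1] in auto)
    show ?case
      using \<epsilon> \<delta> mono[of _ _ \<epsilon> "min \<epsilon> \<delta>"] mono[of _ _ \<delta> "min \<epsilon> \<delta>"] by (intro exI[of _ "min \<epsilon> \<delta>"]) auto
  qed
  obtain \<epsilon> where \<epsilon>: "\<epsilon> > 0" "\<And>s. s \<in> S \<Longrightarrow> 0 \<le> \<phi> s \<Longrightarrow> (t, s \<otimes> t) \<in> (R \<epsilon>)\<^sup>*"
    using bound[OF Sc(1) subset_refl] by auto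
  \<comment> \<open>Translating by \<open>p\<close> gains \<epsilon> over the value at
    \<open>p\<close>, which is the lower end of the edge because \<open>0 \<le> \<phi> s\<close>.
    Descending edges are traversed backwards in \<open>raise_edge\<close>.\<close>
  have raise_up: "(p \<otimes> t, p \<otimes> s \<otimes> t) \<in> (R (c + \<epsilon>))\<^sup>*"
    if "p \<in> carrier G" "s \<in> S" "0 \<le> \<phi> s" "c \<le> \<phi> p" for p s c
    using left[OF \<epsilon>(2)[OF that(2,3)] that(1)] that Sc(2) mono[of "p \<otimes> t" "p \<otimes> s \<otimes> t" "\<epsilon> + \<phi> p" "c + \<epsilon>"]
    by (auto simp: m_assoc)
  have raise_edge: "(p \<otimes> t, p \<otimes> s \<otimes> t) \<in> (R (c + \<epsilon>))\<^sup>*"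
    if "p \<in> carrier G" "s \<in> S" "c \<le> \<phi> p" "c \<le> \<phi> (p \<otimes> s)" for p s c
  proof (cases "0 \<le> \<phi> s")
    case True
    then show ?thesis
      using that raise_up by blast
  next
    case False
    have s: "s \<in> carrier G"
      using that Sc by auto
    then have "0 \<le> \<phi> (inv s)"
      using False inv by simp
    then have "(p \<otimes> s \<otimes> t, p \<otimes> s \<otimes> inv s \<otimes> t) \<in> (R (c + \<epsilon>))\<^sup>*"
      using that s by (intro raise_up S_inv) auto
    then show ?thesis
      using symR that s by (simp add: m_assoc)
  qed
  have raise: "(x \<otimes> t, y \<otimes> t) \<in> (R (c + \<epsilon>))\<^sup>*" if "(x, y) \<in> (R c)\<^sup>*" for x y c
    using that
  proof (induction rule: rtrancl_induct)
    case (step y z)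
    have yz: "y \<in> carrier G" "z \<in> carrier G" "c \<le> \<phi> y" "c \<le> \<phi> z"
      using step(2) by (auto simp: R_def)
    from step(2) obtain s where s: "s \<in> S" "z = y \<otimes> s \<or> y = z \<otimes> s"
      by (auto simp: R_def cayley_graph_def)
    have "(y \<otimes> t, z \<otimes> t) \<in> (R (c + \<epsilon>))\<^sup>*"
      using s(2)
    proof
      assume "z = y \<otimes> s"
      then show ?thesis
        using raise_edge yz s(1) by simp
    next
      assume "y = z \<otimes> s"
      then show ?thesis
        using raise_edge[of z s c] yz s(1) symR by simp
    qed
    with step.IH show ?case
      by (rule rtrancl_trans)
  qed simp
  have raise_pow: "(x \<otimes> t [^] n, y \<otimes> t [^] n) \<in> (R (c + n * \<epsilon>))\<^sup>*"
    if "(x, y) \<in> (R c)\<^sup>*" "x \<in> carrier G" "y \<in> carrier G" for x y c and n :: nat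
  proof (induction n)
    case 0
    then show ?case using that by simp
  next
    case (Suc n)
    have "(x \<otimes> t [^] n \<otimes> t, y \<otimes> t [^] n \<otimes> t) \<in> (R (c + n * \<epsilon> + \<epsilon>))\<^sup>*"
      using Suc by (rule raise)
    then show ?case
      using that by (simp add: m_assoc algebra_simps)
  qed
  have whole: "\<exists>c. (x, x \<otimes> g) \<in> (R c)\<^sup>*" if "g \<in> generate G S" "x \<in> carrier G" for g x
    using that
  proof (induction arbitrary: x rule: generate.induct)
    case (incl s)
    then show ?case
      using R_step[of x s "min (\<phi> x) (\<phi> (x \<otimes> s))"] by auto
  next
    case (inv s)
    then show ?case
      using R_step[of x "inv s" "min (\<phi> x) (\<phi> (x \<otimes> inv s))"] S_inv by auto
  next
    case (eng g h)
    have gh: "g \<in> carrier G" "h \<in> carrier G"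
      using eng Sc by auto
    obtain c d where "(x, x \<otimes> g) \<in> (R c)\<^sup>*" "(x \<otimes> g, x \<otimes> g \<otimes> h) \<in> (R d)\<^sup>*"
      using eng gh by (meson m_closed)
    then have "(x, x \<otimes> (g \<otimes> h)) \<in> (R (min c d))\<^sup>*"
      using mono[of x "x \<otimes> g" c "min c d"] mono[of "x \<otimes> g" "x \<otimes> g \<otimes> h" d "min c d"] eng.prems gh
      by (simp add: m_assoc)
    then show ?case by blast
  qed auto
  have climb: "(x, x \<otimes> t [^] n) \<in> (R 0)\<^sup>* \<and> 0 \<le> \<phi> (x \<otimes> t [^] n)" if "x \<in> carrier G" "0 \<le> \<phi> x" for x and n :: nat
  proof (induction n)
    case (Suc n)
    then have "(x \<otimes> t [^] n, x \<otimes> t [^] n \<otimes> t) \<in> R 0"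
      using that t by (intro R_step) (auto simp: hom)
    then show ?case
      using Suc that t by (auto simp: m_assoc[symmetric] hom intro: rtrancl_into_rtrancl)
  qed (use that in simp)
  let ?P = "{g \<in> carrier G. 0 \<le> \<phi> g}"
  have "(x, y) \<in> (R 0)\<^sup>*" if "x \<in> ?P" "y \<in> ?P" for x y
  proof -
    have xy: "x \<in> carrier G" "y \<in> carrier G" "0 \<le> \<phi> x" "0 \<le> \<phi> y"
      using that by auto
    have "inv x \<otimes> y \<in> generate G S"
      using xy Sc by simp
    then obtain c where "(x, x \<otimes> (inv x \<otimes> y)) \<in> (R c)\<^sup>*"
      using whole xy by blast
    then have c: "(x, y) \<in> (R c)\<^sup>*"
      using xy by (simp add: m_assoc[symmetric])
    \<comment> \<open>Raising the path \<open>n\<close> times outweighs its depth, and the climbs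
      from \<open>x\<close> and \<open>y\<close> to its new ends never go below zero.\<close>
    obtain n :: nat where "- c \<le> n * \<epsilon>"
      using reals_Archimedean3[OF \<epsilon>(1)] by (meson less_imp_le)
    then have "(x \<otimes> t [^] n, y \<otimes> t [^] n) \<in> (R 0)\<^sup>*"
      using mono[OF raise_pow[OF c xy(1,2), of n], of 0] by simp
    then show ?thesis
      using climb[OF xy(1,3), of n] climb[OF xy(2,4), of n] symR by (meson rtrancl_trans)
  qed
  moreover have "\<one> \<in> ?P"
    using one by simp
  ultimately show ?thesis
    by (auto simp: nonneg_connected_def cayley_reachable_iff R_def)
qed

text \<open>For each generator \<open>s\<close> of non-negative value, a path from \<open>t\<close>
  to \<open>s t\<close> of positive elements is needed. Chains of commuting live edges first join
  \<open>t\<close> to every generator of positive value.\<close>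

lemma (in bb_character) nonseparating_imp_nonneg_connected:
  assumes "nonseparating_levels (pverts \<Gamma>) (parcs \<Gamma>) potential"
  shows "nonneg_connected (bb_group \<Gamma>) edges \<phi>"
proof -
  interpret N: nonseparating_levels "pverts \<Gamma>" "parcs \<Gamma>" potential
    by fact
  define P where "P = {g \<in> carrier (bb_group \<Gamma>). 0 < \<phi> g}"
  define R where "R = parcs (cayley_graph (bb_group \<Gamma>) edges) \<inter> P \<times> P"
  have mult: "g \<otimes>\<^bsub>raag \<Gamma>\<^esub> h \<in> carrier (bb_group \<Gamma>)"
    if "g \<in> carrier (bb_group \<Gamma>)" "h \<in> carrier (bb_group \<Gamma>)" for g h
    using B.m_closed[OF that] by simp
  have assoc: "g \<otimes>\<^bsub>raag \<Gamma>\<^esub> h \<otimes>\<^bsub>raag \<Gamma>\<^esub> k = g \<otimes>\<^bsub>raag \<Gamma>\<^esub> (h \<otimes>\<^bsub>raag \<Gamma>\<^esub> k)"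
    if "g \<in> carrier (bb_group \<Gamma>)" "h \<in> carrier (bb_group \<Gamma>)" "k \<in> carrier (bb_group \<Gamma>)" for g h k
    using B.m_assoc[OF that] by simp
  have edges: "s \<in> carrier (bb_group \<Gamma>)" if "s \<in> edges" for s
    using edges_closed that by blast
  have step: "(g, g \<otimes>\<^bsub>raag \<Gamma>\<^esub> s) \<in> R" if "g \<in> P" "g \<otimes>\<^bsub>raag \<Gamma>\<^esub> s \<in> P" "s \<in> edges" for g s
    using that unfolding R_def cayley_graph_def P_def by simp blast
  have symR: "(h, g) \<in> R\<^sup>*" if "(g, h) \<in> R\<^sup>*" for g h
  proof -
    have "sym R"
      by (auto simp: R_def cayley_graph_def sym_def)
    then show ?thesis
      using that by (meson sym_rtrancl symD)
  qed
  have left: "(a \<otimes>\<^bsub>raag \<Gamma>\<^esub> g, a \<otimes>\<^bsub>raag \<Gamma>\<^esub> h) \<in> R\<^sup>*"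
    if "(g, h) \<in> R\<^sup>*" "a \<in> carrier (bb_group \<Gamma>)" "0 \<le> \<phi> a" for a g h
    using that(1)
  proof (induction rule: rtrancl_induct)
    case (step y z)
    have yz: "y \<in> P" "z \<in> P"
      using step(2) by (auto simp: R_def)
    then have ayz: "a \<otimes>\<^bsub>raag \<Gamma>\<^esub> y \<in> P" "a \<otimes>\<^bsub>raag \<Gamma>\<^esub> z \<in> P"
      using that by (auto simp: P_def \<phi>_mult mult)
    obtain s where s: "s \<in> edges" "z = y \<otimes>\<^bsub>raag \<Gamma>\<^esub> s \<or> y = z \<otimes>\<^bsub>raag \<Gamma>\<^esub> s"
      using step(2) by (auto simp: R_def cayley_graph_def)
    then have "a \<otimes>\<^bsub>raag \<Gamma>\<^esub> z = a \<otimes>\<^bsub>raag \<Gamma>\<^esub> y \<otimes>\<^bsub>raag \<Gamma>\<^esub> s \<or> a \<otimes>\<^bsub>raag \<Gamma>\<^esub> y = a \<otimes>\<^bsub>raag \<Gamma>\<^esub> z \<otimes>\<^bsub>raag \<Gamma>\<^esub> s"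
      using yz that(2) edges by (auto simp: P_def assoc)
    then have "(a \<otimes>\<^bsub>raag \<Gamma>\<^esub> y, a \<otimes>\<^bsub>raag \<Gamma>\<^esub> z) \<in> R"
      using ayz s(1) unfolding R_def cayley_graph_def P_def by auto
    with step(3) show ?case
      by (rule rtrancl_into_rtrancl)
  qed simp
  define up where "up = (\<lambda>(u, v).
      if potential u < potential v then edge_element \<Gamma> (u, v) else edge_element \<Gamma> (v, u))"
  have live: "(u, v) \<in> parcs \<Gamma>" "u \<in> pverts \<Gamma>" "v \<in> pverts \<Gamma>" if "(u, v) \<in> N.live" for u v
    using that by (auto simp: N.live_def dest: in_arcsD1 in_arcsD2)
  have up: "up e \<in> edges" "up e \<in> P" if e: "e \<in> N.live" for e
  proof -
    obtain u v where uv: "e = (u, v)" "(u, v) \<in> N.live"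
      using e by (cases e) auto
    show "up e \<in> edges"
      using live[OF uv(2)] arcs_sym by (auto simp: uv(1) up_def)
    then show "up e \<in> P"
      using live[OF uv(2)] uv(2) edges by (auto simp: P_def uv(1) up_def \<phi>_edge_element N.live_def)
  qed
  have commute: "(up e, up e') \<in> R\<^sup>*" if ee: "(e, e') \<in> N.commuting" for e e'
  proof -
    obtain u v u' v' where e: "e = (u, v)" "e' = (u', v')" "(u, v) \<in> N.live" "(u', v') \<in> N.live"
        "\<forall>p\<in>{u, v}. \<forall>q\<in>{u', v'}. p = q \<or> (p, q) \<in> parcs \<Gamma>"
      using ee by (auto simp: N.commuting_def)
    have comm: "up e \<otimes>\<^bsub>raag \<Gamma>\<^esub> up e' = up e' \<otimes>\<^bsub>raag \<Gamma>\<^esub> up e"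
      using e live[OF e(3)] live[OF e(4)] unfolding e(1,2) up_def
      by (auto intro!: edge_element_commute)
    have U: "up e \<in> P" "up e' \<in> P" "up e \<in> edges" "up e' \<in> edges"
      using up e by auto
    then have "up e \<otimes>\<^bsub>raag \<Gamma>\<^esub> up e' \<in> P"
      by (auto simp: P_def mult \<phi>_mult)
    then have "(up e, up e \<otimes>\<^bsub>raag \<Gamma>\<^esub> up e') \<in> R" "(up e', up e \<otimes>\<^bsub>raag \<Gamma>\<^esub> up e') \<in> R"
      using step[of "up e" "up e'"] step[of "up e'" "up e"] U comm by auto
    then show ?thesis
      using symR by (meson r_into_rtrancl rtrancl_trans)
  qed
  have all_up: "(up e, up e') \<in> R\<^sup>*" if "e \<in> N.live" "e' \<in> N.live" for e e'
  proof -
    have "(e, e') \<in> N.commuting\<^sup>*"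
      using N.commuting_live_connected that by (metis surj_pair)
    then show ?thesis
      by (induction rule: rtrancl_induct) (auto intro: commute rtrancl_trans)
  qed
  obtain v0 where v0: "v0 \<in> pverts \<Gamma>"
    using potential_nonconstant by blast
  obtain v1 where "(v0, v1) \<in> parcs \<Gamma>" "potential v0 \<noteq> potential v1"
    using N.live_neighbour[OF v0] by blast
  then obtain e0 where e0: "e0 \<in> N.live"
    by (auto simp: N.live_def)
  define t where "t = up e0"
  have t: "t \<in> edges" "t \<in> P" "t \<in> carrier (bb_group \<Gamma>)" "0 < \<phi> t"
    using up[OF e0] by (auto simp: t_def P_def)
  have t_up: "(t, up e) \<in> R\<^sup>*" if e: "e \<in> N.live" for e
    using all_up[OF e0 that] by (simp add: t_def)
  show ?thesis
  proof (rule nonneg_connectedI[OF group_bb_group, where t = t])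
    show "\<phi> (g \<otimes>\<^bsub>bb_group \<Gamma>\<^esub> h) = \<phi> g + \<phi> h"
      if "g \<in> carrier (bb_group \<Gamma>)" "h \<in> carrier (bb_group \<Gamma>)" for g h
      using that \<phi>_mult by simp
    show "inv\<^bsub>bb_group \<Gamma>\<^esub> s \<in> edges" if s: "s \<in> edges" for s
    proof -
      obtain u v where uv: "(u, v) \<in> parcs \<Gamma>" "s = edge_element \<Gamma> (u, v)"
        using s by auto
      have V: "u \<in> pverts \<Gamma>" "v \<in> pverts \<Gamma>"
        using uv(1) in_arcsD1 in_arcsD2 by auto
      have "inv\<^bsub>bb_group \<Gamma>\<^esub> s = edge_element \<Gamma> (v, u)"
        unfolding uv(2) inv_bb_group[OF edge_element_closed[OF V]] edge_element_swap[OF V] ..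
      then show ?thesis
        using arcs_sym[OF uv(1)] by auto
    qed
    have "(t, s \<otimes>\<^bsub>raag \<Gamma>\<^esub> t) \<in> R\<^sup>*" if s: "s \<in> edges" "0 \<le> \<phi> s" for s
    proof -
      obtain u v where uv: "(u, v) \<in> parcs \<Gamma>" "s = edge_element \<Gamma> (u, v)"
        using s by auto
      have V: "u \<in> pverts \<Gamma>" "v \<in> pverts \<Gamma>"
        using uv(1) in_arcsD1 in_arcsD2 by auto
      have sc: "s \<in> carrier (bb_group \<Gamma>)"
        using s edges by blast
      show ?thesis
      proof (cases "potential u = potential v")
        case False
        then have l: "(u, v) \<in> N.live" and "s = up (u, v)"
          using uv s(2) V by (auto simp: N.live_def up_def \<phi>_edge_element)
        then have ts: "(t, s) \<in> R\<^sup>*" and "s \<in> P"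
          using t_up[OF l] up[OF l] by auto
        \<comment> \<open>The route is from \<open>t\<close> to \<open>s\<close>, along an edge to
          \<open>s s\<close>, and on to \<open>s t\<close> by the \<open>s\<close>-translate of the
          reversed first part.\<close>
        then have "s \<otimes>\<^bsub>raag \<Gamma>\<^esub> s \<in> P"
          by (auto simp: P_def mult \<phi>_mult)
        then have "(s, s \<otimes>\<^bsub>raag \<Gamma>\<^esub> s) \<in> R"
          using step \<open>s \<in> P\<close> s(1) by blast
        moreover have "(s \<otimes>\<^bsub>raag \<Gamma>\<^esub> t, s \<otimes>\<^bsub>raag \<Gamma>\<^esub> s) \<in> R\<^sup>*"
          using left[OF ts sc s(2)] .
        ultimately show ?thesis
          using ts symR by (meson r_into_rtrancl rtrancl_trans)
      next
        case True
        \<comment> \<open>A dead edge has value zero, so translating by it preserves positivity; it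
          can be replaced by a product of dominated edges, each handled by its own triangle.\<close>
        then have "(u, v) \<in> N.dominated\<^sup>*"
          using uv(1) by (intro N.dead_imp_dominated) (simp add: N.dead_def)
        then have "v \<in> pverts \<Gamma> \<and> (t, edge_element \<Gamma> (u, v) \<otimes>\<^bsub>raag \<Gamma>\<^esub> t) \<in> R\<^sup>*"
        proof (induction rule: rtrancl_induct)
          case base
          have "\<one>\<^bsub>raag \<Gamma>\<^esub> \<otimes>\<^bsub>raag \<Gamma>\<^esub> t = t"
            using B.l_one[OF t(3)] by simp
          then show ?case
            using V by (simp add: edge_element_self)
        next
          case (step x y)
          then obtain z where z: "(x, y) \<in> parcs \<Gamma>" "potential x = potential y"
              "(x, z) \<in> N.live" "(y, z) \<in> parcs \<Gamma>"
            by (auto simp: N.dominated_def N.dead_def)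
          define s1 where "s1 = edge_element \<Gamma> (x, y)"
          have xyz: "x \<in> pverts \<Gamma>" "y \<in> pverts \<Gamma>" "z \<in> pverts \<Gamma>" "(x, z) \<in> parcs \<Gamma>"
            using z(1,4) live[OF z(3)] in_arcsD2 by auto
          have s1: "s1 \<in> edges" "s1 \<in> carrier (bb_group \<Gamma>)" "\<phi> s1 = 0"
            using z xyz by (auto simp: s1_def edge_element_closed \<phi>_edge_element)
          \<comment> \<open>A live side of the triangle, commuting with \<open>s1\<close>. The route
            is from \<open>t\<close> to \<open>p\<close>, along an edge to
            \<open>p s1 = s1 p\<close>, and back to \<open>s1 t\<close> by the
            \<open>s1\<close>-translate.\<close>
          define p where "p = up (x, z)"
          have p: "p \<in> P" "(t, p) \<in> R\<^sup>*"
            using up[OF z(3)] t_up[OF z(3)] by (auto simp: p_def)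
          have comm: "s1 \<otimes>\<^bsub>raag \<Gamma>\<^esub> p = p \<otimes>\<^bsub>raag \<Gamma>\<^esub> s1"
            using xyz z(1,4) arcs_sym[OF z(1)] unfolding s1_def p_def up_def
            by (auto intro!: edge_element_commute)
          have "p \<otimes>\<^bsub>raag \<Gamma>\<^esub> s1 \<in> P"
            using p s1 by (auto simp: P_def mult \<phi>_mult)
          then have "(p, s1 \<otimes>\<^bsub>raag \<Gamma>\<^esub> p) \<in> R"
            using \<open>\<And>s g. g \<in> P \<Longrightarrow> g \<otimes>\<^bsub>raag \<Gamma>\<^esub> s \<in> P \<Longrightarrow> s \<in> edges \<Longrightarrow> (g, g \<otimes>\<^bsub>raag \<Gamma>\<^esub> s) \<in> R\<close> p s1 comm by auto
          moreover have "(s1 \<otimes>\<^bsub>raag \<Gamma>\<^esub> t, s1 \<otimes>\<^bsub>raag \<Gamma>\<^esub> p) \<in> R\<^sup>*"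
            using p(2) s1 by (intro left) auto
          ultimately have "(t, s1 \<otimes>\<^bsub>raag \<Gamma>\<^esub> t) \<in> R\<^sup>*"
            using p(2) symR by (meson r_into_rtrancl rtrancl_trans)
          moreover have "(s1 \<otimes>\<^bsub>raag \<Gamma>\<^esub> t, s1 \<otimes>\<^bsub>raag \<Gamma>\<^esub> (edge_element \<Gamma> (u, x) \<otimes>\<^bsub>raag \<Gamma>\<^esub> t)) \<in> R\<^sup>*"
            using step.IH s1 by (intro left) auto
          moreover have "s1 \<otimes>\<^bsub>raag \<Gamma>\<^esub> (edge_element \<Gamma> (u, x) \<otimes>\<^bsub>raag \<Gamma>\<^esub> t) = edge_element \<Gamma> (u, y) \<otimes>\<^bsub>raag \<Gamma>\<^esub> t"
            using V xyz s1(2) t(3) edge_element_mult[of u \<Gamma> x y]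
            by (simp add: assoc[symmetric] edge_element_closed) (simp add: s1_def)
          ultimately show ?case
            using xyz(2) by (metis rtrancl_trans)
        qed
        then show ?thesis
          by (simp add: uv(2))
      qed
    qed
    then show "(t, s \<otimes>\<^bsub>bb_group \<Gamma>\<^esub> t) \<in> (parcs (cayley_graph (bb_group \<Gamma>) edges) \<inter>
        {g \<in> carrier (bb_group \<Gamma>). 0 < \<phi> g} \<times> {g \<in> carrier (bb_group \<Gamma>). 0 < \<phi> g})\<^sup>*"
      if "s \<in> edges" "0 \<le> \<phi> s" for s
      using that by (simp add: R_def P_def)
  qed (use t finite_generating_edges in auto)
qed

subsection \<open>The dead edge subgraph\<close>

lemma connected_with_proj_restrict:
  assumes "pair_graph \<Gamma>"
  shows "Digraph_Component.connected (with_proj \<Gamma> \<restriction> W) \<longleftrightarrow> W \<noteq> {} \<and> connected_on (parcs \<Gamma>) W"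
proof -
  interpret pair_graph \<Gamma> by fact
  let ?H = "with_proj \<Gamma> \<restriction> W"
  have "sym (parcs \<Gamma>)"
    using pair_sym_arcs by (simp add: symmetric_def)
  moreover have ends: "arcs_ends ?H = parcs \<Gamma> \<inter> W \<times> W"
    by (force simp: arcs_ends_conv)
  ultimately have "(arcs_ends ?H)\<^sup>s = parcs \<Gamma> \<inter> W \<times> W"
    by (auto simp: symcl_def sym_def)
  moreover have "(g, h) \<in> rtrancl_on W (parcs \<Gamma> \<inter> W \<times> W) \<longleftrightarrow> (g, h) \<in> (parcs \<Gamma> \<inter> W \<times> W)\<^sup>*"
    if "g \<in> W" for g h
  proof
    assume "(g, h) \<in> (parcs \<Gamma> \<inter> W \<times> W)\<^sup>*"
    then show "(g, h) \<in> rtrancl_on W (parcs \<Gamma> \<inter> W \<times> W)"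
      using that by (induction rule: rtrancl_induct) (auto intro: rtrancl_on_into_rtrancl_on)
  qed (rule rtrancl_on_rtranclI)
  ultimately show ?thesis
    by (simp add: connected_conv connected_on_def)
qed

lemma disconnected_graph_restrict:
  assumes "pair_graph \<Gamma>"
  shows "disconnected_graph (with_proj \<Gamma> \<restriction> W) \<longleftrightarrow> \<not> connected_on (parcs \<Gamma>) W"
  using connected_with_proj_restrict[OF assms, of W]
  by (auto simp: disconnected_graph_def connected_on_def)

lemma with_proj_restrict_pverts:
  assumes "pair_graph \<Gamma>"
  shows "with_proj \<Gamma> \<restriction> pverts \<Gamma> = with_proj \<Gamma>"
proof -
  interpret pair_graph \<Gamma> by fact
  have "{e \<in> parcs \<Gamma>. fst e \<in> pverts \<Gamma> \<and> snd e \<in> pverts \<Gamma>} = parcs \<Gamma>"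
    using arc_fst_in_verts arc_snd_in_verts by blast
  then show ?thesis
    by (simp add: induce_subgraph_def with_proj_def)
qed

theorem theoremC:
  fixes \<Gamma> :: "'v pair_pre_digraph" and \<phi> :: "'v word set \<Rightarrow> real"
  assumes "pair_graph \<Gamma>"
    and "biconnected (with_proj \<Gamma>)"
    and "simply_connected (geometric_realization (flag_complex \<Gamma>))"
    and "\<phi> \<in> nonzero_characters (bb_group \<Gamma>)"
  shows "character_class (bb_group \<Gamma>) \<phi> \<in> bns_invariant (bb_group \<Gamma>) \<longleftrightarrow>
    \<not> (\<exists>\<Lambda>. subgraph \<Lambda> (with_proj (dead_edge_subgraph \<Gamma> \<phi>)) \<and>
         induced_subgraph \<Lambda> (with_proj \<Gamma>) \<and> separates \<Lambda> (with_proj \<Gamma>))"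
proof -
  interpret pair_graph \<Gamma> by fact
  define V where "V = pverts \<Gamma>"
  define E where "E = parcs \<Gamma>"
  have disc: "disconnected_graph (with_proj \<Gamma> \<restriction> W) \<longleftrightarrow> \<not> connected_on E W" for W
    unfolding E_def by (rule disconnected_graph_restrict) fact
  have con: "connected_on E V"
    using assms(2) connected_with_proj_restrict[OF assms(1), of "pverts \<Gamma>"]
    by (simp add: biconnected_def with_proj_restrict_pverts[OF assms(1)] E_def V_def)
  interpret connected_pair_graph \<Gamma>
  proof
    fix u v assume "u \<in> pverts \<Gamma>" "v \<in> pverts \<Gamma>"
    then have "(u, v) \<in> (E \<inter> V \<times> V)\<^sup>*"
      using con by (simp add: connected_on_def V_def)
    then show "(u, v) \<in> (parcs \<Gamma>)\<^sup>*"
      by (rule rtrancl_mono[THEN subsetD, rotated]) (auto simp: E_def)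
  qed
  interpret bb_character \<Gamma> \<phi>
    by unfold_locales fact
  interpret acyclic_graph V E
  proof
    show "finite V"
      unfolding V_def by (rule pair_finite_verts)
    show "(v, u) \<in> E" if "(u, v) \<in> E" for u v
      using that arcs_sym by (simp add: E_def)
    show "(u, u) \<notin> E" for u
      using pair_no_loops by (force simp: E_def)
    show "u \<in> V" if "(u, v) \<in> E" for u v
      using that in_arcsD1 by (simp add: E_def V_def)
    show "connected_on E V"
      by (rule con)
    show "coboundary E c" if "cocycle E c" for c
      using simply_connected_imp_coboundary[OF assms(1,3) rtrancl_arcs] that by (simp add: E_def)
  qed
  have dead_iff: "\<phi> (edge_element \<Gamma> (u, v)) = 0 \<longleftrightarrow> potential u = potential v" if "(u, v) \<in> E" for u v
    using \<phi>_edge_element[of u v] E_V[OF that] E_V'[OF that] by (auto simp: V_def)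
  have "nonneg_connected (bb_group \<Gamma>) edges \<phi> \<longleftrightarrow>
      \<not> (\<exists>\<Lambda>. subgraph \<Lambda> (with_proj (dead_edge_subgraph \<Gamma> \<phi>)) \<and>
           induced_subgraph \<Lambda> (with_proj \<Gamma>) \<and> separates \<Lambda> (with_proj \<Gamma>))" (is "_ \<longleftrightarrow> \<not> ?sep")
  proof (intro iffI notI)
    assume nc: "nonneg_connected (bb_group \<Gamma>) edges \<phi>" and ?sep
    then obtain \<Lambda> where \<Lambda>: "subgraph \<Lambda> (with_proj (dead_edge_subgraph \<Gamma> \<phi>))"
        "induced_subgraph \<Lambda> (with_proj \<Gamma>)" "separates \<Lambda> (with_proj \<Gamma>)"
      by blast
    have "verts \<Lambda> \<subseteq> V"
      using \<Lambda>(2) by (simp add: induced_subgraph_def subgraph_def V_def)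
    moreover have "\<not> connected_on E (V - verts \<Lambda>)"
      using \<Lambda>(3) disc by (simp add: separates_def V_def)
    ultimately obtain C where C: "C \<subseteq> verts \<Lambda>" "C \<noteq> {}" "connected_on E C" "\<not> connected_on E (V - C)"
      by (rule separating_connected_subset)
    obtain c where c: "c \<in> C"
      using C(2) by blast
    have level: "potential x = potential c" if "x \<in> C" for x
      using C(3) that c
    proof (rule connected_on_invariant)
      fix y z assume yz: "(y, z) \<in> E" "y \<in> C" "z \<in> C"
      \<comment> \<open>Fullness enters here: an edge of the graph between vertices of
        \<open>C\<close> belongs to the subgraph, hence is dead.\<close>
      then have "(y, z) \<in> arcs \<Lambda>"
        using \<Lambda>(2) C(1) by (auto simp: induced_subgraph_def E_def)
      then have "(y, z) \<in> parcs (dead_edge_subgraph \<Gamma> \<phi>)"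
        using \<Lambda>(1) by (auto simp: subgraph_def)
      then show "potential y = potential z"
        using dead_iff[OF yz(1)] by (simp add: dead_edge_subgraph_def Let_def)
    qed
    obtain a b where ab: "a \<in> V - C" "b \<in> V - C" "(a, b) \<notin> (E \<inter> (V - C) \<times> (V - C))\<^sup>*"
      using C(4) by (auto simp: connected_on_def)
    define A where "A = {z \<in> V - C. (a, z) \<in> (E \<inter> (V - C) \<times> (V - C))\<^sup>*}"
    define B where "B = V - C - A"
    have AB: "a \<in> A" "b \<in> B" "A \<inter> B = {}" "A \<inter> C = {}" "B \<inter> C = {}" "pverts \<Gamma> = A \<union> B \<union> C"
      using ab C(1) \<open>verts \<Lambda> \<subseteq> V\<close> by (auto simp: A_def B_def V_def)
    have no_edge: "(x, y) \<notin> parcs \<Gamma>" if "x \<in> A" "y \<in> B" for x y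
      using that by (auto simp: A_def B_def E_def intro: rtrancl_into_rtrancl)
    then have no_edge': "(y, x) \<notin> parcs \<Gamma>" if "x \<in> A" "y \<in> B" for x y
      using that arcs_sym by blast
    obtain x where x: "x \<in> pverts \<Gamma>" "potential x \<noteq> potential c"
      using potential_nonconstant by blast
    \<comment> \<open>The splitting argument wants a vertex off the level on its first side; the two
      sides may be interchanged.\<close>
    have "x \<in> A \<or> x \<in> B"
      using x level AB(6) by auto
    then show False
    proof
      assume "x \<in> A"
      then show False
        using separating_level_not_nonneg_connected[OF AB(6,3,4,5) no_edge _ x(2) AB(2) c level] nc by blast
    next
      assume "x \<in> B"
      moreover have "pverts \<Gamma> = B \<union> A \<union> C" "B \<inter> A = {}"
        using AB by auto
      ultimately show False
        using separating_level_not_nonneg_connected[OF _ _ AB(5,4) no_edge' _ x(2) AB(1) c level] nc by blast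
    qed
  next
    assume not_sep: "\<not> ?sep"
    \<comment> \<open>The vertices of \<open>W\<close> must lie on dead edges, but these edges may
      leave \<open>W\<close>; the subgraph spanned by \<open>W\<close> is still contained in the
      dead edge subgraph.\<close>
    have full: "connected_on E (V - W)"
      if W: "W \<subseteq> V" "\<And>x. x \<in> W \<Longrightarrow> \<exists>y. (x, y) \<in> E \<and> potential x = potential y"
        "\<And>x y. x \<in> W \<Longrightarrow> y \<in> W \<Longrightarrow> (x, y) \<in> E \<Longrightarrow> potential x = potential y" for W
    proof -
      let ?\<Lambda> = "with_proj \<Gamma> \<restriction> W" and ?D = "dead_edge_subgraph \<Gamma> \<phi>"
      have arcs_D: "parcs ?D = {(u, v). (u, v) \<in> E \<and> potential u = potential v}"
        using dead_iff by (auto simp: dead_edge_subgraph_def Let_def E_def)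
      have verts_D: "pverts ?D = fst ` parcs ?D \<union> snd ` parcs ?D"
        by (simp add: dead_edge_subgraph_def Let_def)
      have "wf_digraph (with_proj ?D)"
        by (intro wf_digraph.intro) (auto simp: verts_D)
      moreover have "wf_digraph ?\<Lambda>"
        by (rule wellformed_induce_subgraph)
      moreover have "W \<subseteq> pverts ?D"
        using W(2) unfolding verts_D arcs_D by force
      ultimately have "subgraph ?\<Lambda> (with_proj ?D)"
        using W(3) by (auto simp: subgraph_def compatible_def arcs_D E_def)
      moreover have "induced_subgraph ?\<Lambda> (with_proj \<Gamma>)"
        using W(1) by (intro induced_induce) (simp add: V_def)
      ultimately have "\<not> separates ?\<Lambda> (with_proj \<Gamma>)"
        using not_sep by blast
      then show ?thesis
        using disc by (simp add: separates_def V_def)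
    qed
    interpret nonseparating_levels V E potential
    proof
      fix x assume x: "x \<in> V"
      define dead where "dead = {(p, q). (p, q) \<in> E \<and> potential p = potential q}"
      define W where "W = {y. (x, y) \<in> dead\<^sup>*}"
      have W_V: "y \<in> V" "potential x = potential y" if "y \<in> W" for y
      proof -
        have xy: "(x, y) \<in> dead\<^sup>*"
          using that by (simp add: W_def)
        then show "y \<in> V"
          by (rule rtranclE) (use x E_V' in \<open>auto simp: dead_def\<close>)
        show "potential x = potential y"
          using xy by (rule rtrancl_invariant) (auto simp: dead_def)
      qed
      have "connected_on E (V - W)"
      \<comment> \<open>A one-point component lies on no dead edge, so it is not in the dead edge
        subgraph and the hypothesis is silent about it; the absence of cut vertices covers this
        case.\<close>
      proof (cases "W = {x}")
        case True
        then show ?thesis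
          using assms(2) x disc[of "V - {x}"] by (auto simp: biconnected_def cut_vertex_def V_def)
      next
        case False
        moreover have "x \<in> W"
          by (simp add: W_def)
        ultimately obtain z where z: "(x, z) \<in> dead\<^sup>*" "z \<noteq> x"
          by (auto simp: W_def)
        show ?thesis
        proof (rule full)
          show "\<exists>y'. (y, y') \<in> E \<and> potential y = potential y'" if y: "y \<in> W" for y
          proof (cases "y = x")
            case True
            then show ?thesis
              using z by (auto simp: dead_def elim: converse_rtranclE)
          next
            case False
            then obtain y' where "(y', y) \<in> dead"
              using y by (auto simp: W_def elim: rtranclE)
            then show ?thesis
              using E_sym by (intro exI[of _ y']) (auto simp: dead_def)
          qed
          show "potential y = potential z" if "y \<in> W" "z \<in> W" for y z
            using W_V(2) that by metis
        qed (use W_V in auto)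
      qed
      then show "connected_on E (V - {y. (x, y) \<in> {(p, q). (p, q) \<in> E \<and> potential p = potential q}\<^sup>*})"
        by (simp add: W_def dead_def)
      show "\<exists>y. (x, y) \<in> E \<and> potential x \<noteq> potential y"
      proof (rule ccontr)
        assume *: "\<not> ?thesis"
        \<comment> \<open>The link of \<open>x\<close>. If all edges at \<open>x\<close> are dead,
          they place the link in the dead edge subgraph, on one level. Its complement is then
          connected although it contains \<open>x\<close> as an isolated vertex together with a
          vertex off the level.\<close>
        define L where "L = {y. (x, y) \<in> E}"
        have L: "potential y = potential x" if "y \<in> L" for y
          using * that by (auto simp: L_def)
        have con_L: "connected_on E (V - L)"
        proof (rule full)
          show "\<exists>z. (y, z) \<in> E \<and> potential y = potential z" if "y \<in> L" for y
            using L[OF that] that E_sym by (intro exI[of _ x]) (auto simp: L_def)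
        qed (use L E_V' in \<open>auto simp: L_def\<close>)
        obtain z where z: "z \<in> V" "potential z \<noteq> potential x"
          using potential_nonconstant by (auto simp: V_def)
        have "x \<in> V - L" "z \<in> V - L"
          using x z L E_irrefl by (auto simp: L_def)
        with con_L have "(x = x) = (z = x)"
          by (rule connected_on_invariant[where h = "\<lambda>y. y = x"]) (use E_sym in \<open>auto simp: L_def\<close>)
        then show False
          using z by simp
      qed
    qed
    show "nonneg_connected (bb_group \<Gamma>) edges \<phi>"
      by (rule nonseparating_imp_nonneg_connected) (use nonseparating_levels_axioms in \<open>simp add: V_def E_def\<close>)
  qed
  then show ?thesis
    using bns_invariant_iff[OF group_bb_group finite_generating_edges assms(4)] by simp
qed

end
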